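(* Let $\mathcal{H}:\mathsf{M}\to\mathsf{N}$ be a functor with right adjoint $\mathcal{K}:\mathsf{N}\to\mathsf{M}$, with unit $\eta:\mathcal{I}\to\mathcal{K}\mathcal{H}$ and counit $\xi:\mathcal{H}\mathcal{K}\to\mathcal{I}$. The following statements are equivalent. (i) For every comonad $\mathcal{C}$ on $\mathsf{M}$ such that $\mathcal{C}$ and $\mathcal{C}^2$ preserve the equalizer of any parallel pair in $\mathsf{M}$ which is both coreflexive and $\mathcal{H}$-split, the comparison functor $\mathcal{Q}_{\mathcal{C}}:\mathsf{M}_{\mathcal{C}}\to\mathsf{N}_{\mathcal{C}^{\vee}}$ is an equivalence. (ii) The following three conditions hold: (a) any parallel pair in $\mathsf{M}$ which is coreflexive and $\mathcal{H}$-split has an equalizer in $\mathsf{M}$; (b) $\mathcal{H}$ preserves the equalizer of any such pair; (c) $\mathcal{H}$ is conservative.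
   Context: A functor is conservative if it reflects isomorphisms. $\mathcal{I}$ denotes an identity functor. A parallel pair $f,g:X\rightrightarrows Y$ is coreflexive if there is $r:Y\to X$ with $rf=\mathrm{id}=rg$. A split cofork is a diagram $E\xrightarrow{e}X\rightrightarrows Y$ (parallel arrows $f,g$) with $fe=ge$ for which there exist $p:X\to E$ and $q:Y\to X$ with $pe=\mathrm{id}$, $qf=\mathrm{id}$ and $ep=qg$. A parallel pair in $\mathsf{M}$ is $\mathcal{H}$-split if its image under $\mathcal{H}$ is (the parallel pair) part of a split cofork in $\mathsf{N}$. For a comonad $(\mathcal{C},\delta,\epsilon)$ on $\mathsf{M}$, $\mathsf{M}_{\mathcal{C}}$ is the category of $\mathcal{C}$-coalgebras $(M,c)$, $c:M\to\mathcal{C}(M)$. The conjugate comonad of $\mathcal{C}$ under the adjunction $(\mathcal{H},\mathcal{K})$ is the functor $\mathcal{C}^{\vee}=\mathcal{H}\mathcal{C}\mathcal{K}:\mathsf{N}\to\mathsf{N}$ with comultiplication $$\mathcal{H}\mathcal{C}\mathcal{K}\xrightarrow{\mathcal{H}\delta\mathcal{K}}\mathcal{H}\mathcal{C}\mathcal{C}\mathcal{K}\xrightarrow{\mathcal{H}\mathcal{C}\eta\mathcal{C}\mathcal{K}}\mathcal{H}\mathcal{C}\mathcal{K}\mathcal{H}\mathcal{C}\mathcal{K}$$ and counit $\mathcal{H}\mathcal{C}\mathcal{K}\xrightarrow{\mathcal{H}\epsilon\mathcal{K}}\mathcal{H}\mathcal{K}\xrightarrow{\xi}\mathcal{I}$.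 The comparison functor $\mathcal{Q}_{\mathcal{C}}:\mathsf{M}_{\mathcal{C}}\to\mathsf{N}_{\mathcal{C}^{\vee}}$ sends $(M,c)$ to $(\mathcal{H}(M),d)$ with $$d:\mathcal{H}(M)\xrightarrow{\mathcal{H}(c)}\mathcal{H}\mathcal{C}(M)\xrightarrow{\mathcal{H}\mathcal{C}(\eta_M)}\mathcal{H}\mathcal{C}\mathcal{K}\mathcal{H}(M)=\mathcal{C}^{\vee}\mathcal{H}(M),$$ and acts on morphisms as $\mathcal{H}$. *)

theory Defs
  imports Main
begin

section \<open>Categories\<close>

text \<open>Every arrow determines its domain and codomain.  The values of the operations outside
  the sets of objects and arrows are irrelevant: all notions below are relativised to these
  sets.\<close>

record ('o, 'm) cat =
  Obj :: "'o set"
  Arr :: "'m set"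
  Dom :: "'m \<Rightarrow> 'o"
  Cod :: "'m \<Rightarrow> 'o"
  Id :: "'o \<Rightarrow> 'm"
  Comp :: "'m \<Rightarrow> 'm \<Rightarrow> 'm"  (infixr "\<cdot>\<index>" 70)

definition hom :: "('o, 'm) cat \<Rightarrow> 'o \<Rightarrow> 'o \<Rightarrow> 'm set" where
  "hom C X Y = {f \<in> Arr C. Dom C f = X \<and> Cod C f = Y}"

locale category =
  fixes C :: "('o, 'm) cat"
  assumes Dom_in: "f \<in> Arr C \<Longrightarrow> Dom C f \<in> Obj C"
    and Cod_in: "f \<in> Arr C \<Longrightarrow> Cod C f \<in> Obj C"
    and Id_hom: "X \<in> Obj C \<Longrightarrow> Id C X \<in> hom C X X"
    and Comp_hom: "\<lbrakk>f \<in> hom C X Y; g \<in> hom C Y Z\<rbrakk> \<Longrightarrow> g \<cdot>\<^bsub>C\<^esub> f \<in> hom C X Z"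
    and Id_right: "f \<in> hom C X Y \<Longrightarrow> f \<cdot>\<^bsub>C\<^esub> Id C X = f"
    and Id_left: "f \<in> hom C X Y \<Longrightarrow> Id C Y \<cdot>\<^bsub>C\<^esub> f = f"
    and Comp_assoc: "\<lbrakk>f \<in> hom C W X; g \<in> hom C X Y; h \<in> hom C Y Z\<rbrakk>
      \<Longrightarrow> (h \<cdot>\<^bsub>C\<^esub> g) \<cdot>\<^bsub>C\<^esub> f = h \<cdot>\<^bsub>C\<^esub> (g \<cdot>\<^bsub>C\<^esub> f)"

definition is_iso :: "('o, 'm) cat \<Rightarrow> 'm \<Rightarrow> bool" where
  "is_iso C f \<longleftrightarrow> f \<in> Arr C \<and> (\<exists>g \<in> hom C (Cod C f) (Dom C f).
     g \<cdot>\<^bsub>C\<^esub> f = Id C (Dom C f) \<and> f \<cdot>\<^bsub>C\<^esub> g = Id C (Cod C f))"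

definition is_equalizer :: "('o, 'm) cat \<Rightarrow> 'm \<Rightarrow> 'm \<Rightarrow> 'm \<Rightarrow> bool" where
  "is_equalizer C e f g \<longleftrightarrow> (\<exists>E X Y. e \<in> hom C E X \<and> f \<in> hom C X Y \<and> g \<in> hom C X Y \<and>
     f \<cdot>\<^bsub>C\<^esub> e = g \<cdot>\<^bsub>C\<^esub> e \<and>
     (\<forall>Z. \<forall>h \<in> hom C Z X. f \<cdot>\<^bsub>C\<^esub> h = g \<cdot>\<^bsub>C\<^esub> h \<longrightarrow> (\<exists>!k. k \<in> hom C Z E \<and> e \<cdot>\<^bsub>C\<^esub> k = h)))"

definition coreflexive_pair :: "('o, 'm) cat \<Rightarrow> 'm \<Rightarrow> 'm \<Rightarrow> bool" where
  "coreflexive_pair C f g \<longleftrightarrow> (\<exists>X Y. f \<in> hom C X Y \<and> g \<in> hom C X Y \<and>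
     (\<exists>r \<in> hom C Y X. r \<cdot>\<^bsub>C\<^esub> f = Id C X \<and> r \<cdot>\<^bsub>C\<^esub> g = Id C X))"

text \<open>This notion is not symmetric in \<^term>\<open>f\<close> and \<^term>\<open>g\<close>: parallel pairs are ordered.\<close>

definition split_cofork :: "('o, 'm) cat \<Rightarrow> 'm \<Rightarrow> 'm \<Rightarrow> 'm \<Rightarrow> bool" where
  "split_cofork C e f g \<longleftrightarrow> (\<exists>E X Y. e \<in> hom C E X \<and> f \<in> hom C X Y \<and> g \<in> hom C X Y \<and>
     f \<cdot>\<^bsub>C\<^esub> e = g \<cdot>\<^bsub>C\<^esub> e \<and>
     (\<exists>p \<in> hom C X E. \<exists>q \<in> hom C Y X.
        p \<cdot>\<^bsub>C\<^esub> e = Id C E \<and> q \<cdot>\<^bsub>C\<^esub> f = Id C X \<and> e \<cdot>\<^bsub>C\<^esub> p = q \<cdot>\<^bsub>C\<^esub> g))"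


section \<open>Functors and natural transformations\<close>

record ('o, 'm, 'p, 'n) functor_data =
  ob :: "'o \<Rightarrow> 'p"
  ar :: "'m \<Rightarrow> 'n"

locale is_functor = A: category A + B: category B
  for A :: "('o, 'm) cat" and B :: "('p, 'n) cat" +
  fixes F :: "('o, 'm, 'p, 'n) functor_data"
  assumes ob_in: "X \<in> Obj A \<Longrightarrow> ob F X \<in> Obj B"
    and ar_hom: "f \<in> hom A X Y \<Longrightarrow> ar F f \<in> hom B (ob F X) (ob F Y)"
    and ar_Id: "X \<in> Obj A \<Longrightarrow> ar F (Id A X) = Id B (ob F X)"
    and ar_Comp: "\<lbrakk>f \<in> hom A X Y; g \<in> hom A Y Z\<rbrakk>
      \<Longrightarrow> ar F (g \<cdot>\<^bsub>A\<^esub> f) = ar F g \<cdot>\<^bsub>B\<^esub> ar F f"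

definition id_functor :: "('o, 'm, 'o, 'm) functor_data" where
  "id_functor = \<lparr>ob = (\<lambda>X. X), ar = (\<lambda>f. f)\<rparr>"

definition comp_functor ::
  "('p, 'n, 'q, 'k) functor_data \<Rightarrow> ('o, 'm, 'p, 'n) functor_data \<Rightarrow> ('o, 'm, 'q, 'k) functor_data"
  (infixr "\<circ>\<^sub>F" 75) where
  "G \<circ>\<^sub>F F = \<lparr>ob = (\<lambda>X. ob G (ob F X)), ar = (\<lambda>f. ar G (ar F f))\<rparr>"

locale nat_trans = F: is_functor A B F + G: is_functor A B G
  for A :: "('o, 'm) cat" and B :: "('p, 'n) cat" and F G +
  fixes \<tau> :: "'o \<Rightarrow> 'n"
  assumes component_hom: "X \<in> Obj A \<Longrightarrow> \<tau> X \<in> hom B (ob F X) (ob G X)"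
    and naturality: "f \<in> hom A X Y \<Longrightarrow> \<tau> Y \<cdot>\<^bsub>B\<^esub> ar F f = ar G f \<cdot>\<^bsub>B\<^esub> \<tau> X"

locale nat_iso = nat_trans +
  assumes component_iso: "X \<in> Obj A \<Longrightarrow> is_iso B (\<tau> X)"

definition is_equivalence ::
  "('o, 'm) cat \<Rightarrow> ('p, 'n) cat \<Rightarrow> ('o, 'm, 'p, 'n) functor_data \<Rightarrow> bool" where
  "is_equivalence A B F \<longleftrightarrow> is_functor A B F \<and>
     (\<exists>G. is_functor B A G \<and>
        (\<exists>\<alpha>. nat_iso A A id_functor (G \<circ>\<^sub>F F) \<alpha>) \<and>
        (\<exists>\<beta>. nat_iso B B (F \<circ>\<^sub>F G) id_functor \<beta>))"

definition conservative ::
  "('o, 'm) cat \<Rightarrow> ('p, 'n) cat \<Rightarrow> ('o, 'm, 'p, 'n) functor_data \<Rightarrow> bool" where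
  "conservative A B F \<longleftrightarrow> (\<forall>f \<in> Arr A. is_iso B (ar F f) \<longrightarrow> is_iso A f)"

definition functor_split ::
  "('p, 'n) cat \<Rightarrow> ('o, 'm, 'p, 'n) functor_data \<Rightarrow> 'm \<Rightarrow> 'm \<Rightarrow> bool" where
  "functor_split B F f g \<longleftrightarrow> (\<exists>e. split_cofork B e (ar F f) (ar F g))"

text \<open>Preservation does not presuppose existence: whatever equalizer the pair has must be
  sent to an equalizer.\<close>

definition preserves_equalizer ::
  "('o, 'm) cat \<Rightarrow> ('p, 'n) cat \<Rightarrow> ('o, 'm, 'p, 'n) functor_data \<Rightarrow> 'm \<Rightarrow> 'm \<Rightarrow> bool" where
  "preserves_equalizer A B F f g \<longleftrightarrow>
     (\<forall>e. is_equalizer A e f g \<longrightarrow> is_equalizer B (ar F e) (ar F f) (ar F g))"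

locale adjunction =
  H: is_functor M N H + K: is_functor N M K +
  \<eta>: nat_trans M M id_functor "K \<circ>\<^sub>F H" \<eta> + \<xi>: nat_trans N N "H \<circ>\<^sub>F K" id_functor \<xi>
  for M :: "('o, 'm) cat" and N :: "('p, 'n) cat" and H K \<eta> \<xi> +
  assumes triangle_H: "X \<in> Obj M \<Longrightarrow> \<xi> (ob H X) \<cdot>\<^bsub>N\<^esub> ar H (\<eta> X) = Id N (ob H X)"
    and triangle_K: "Y \<in> Obj N \<Longrightarrow> ar K (\<xi> Y) \<cdot>\<^bsub>M\<^esub> \<eta> (ob K Y) = Id M (ob K Y)"


section \<open>Comonads and coalgebras\<close>

locale comonad =
  C: is_functor M M C +
  \<delta>: nat_trans M M C "C \<circ>\<^sub>F C" \<delta> + \<epsilon>: nat_trans M M C id_functor \<epsilon>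
  for M :: "('o, 'm) cat" and C \<delta> \<epsilon> +
  assumes coassoc: "X \<in> Obj M \<Longrightarrow> \<delta> (ob C X) \<cdot>\<^bsub>M\<^esub> \<delta> X = ar C (\<delta> X) \<cdot>\<^bsub>M\<^esub> \<delta> X"
    and counit_left: "X \<in> Obj M \<Longrightarrow> \<epsilon> (ob C X) \<cdot>\<^bsub>M\<^esub> \<delta> X = Id M (ob C X)"
    and counit_right: "X \<in> Obj M \<Longrightarrow> ar C (\<epsilon> X) \<cdot>\<^bsub>M\<^esub> \<delta> X = Id M (ob C X)"

definition coalgebra ::
  "('o, 'm) cat \<Rightarrow> ('o, 'm, 'o, 'm) functor_data \<Rightarrow> ('o \<Rightarrow> 'm) \<Rightarrow> ('o \<Rightarrow> 'm) \<Rightarrow> 'o \<times> 'm \<Rightarrow> bool" where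
  "coalgebra M C \<delta> \<epsilon> = (\<lambda>(X, c). X \<in> Obj M \<and> c \<in> hom M X (ob C X) \<and>
     \<delta> X \<cdot>\<^bsub>M\<^esub> c = ar C c \<cdot>\<^bsub>M\<^esub> c \<and> \<epsilon> X \<cdot>\<^bsub>M\<^esub> c = Id M X)"

text \<open>The same arrow of \<^term>\<open>M\<close> may underlie morphisms between different coalgebras, hence
  a coalgebra morphism is a triple recording its domain and codomain.\<close>

definition coalgebras ::
  "('o, 'm) cat \<Rightarrow> ('o, 'm, 'o, 'm) functor_data \<Rightarrow> ('o \<Rightarrow> 'm) \<Rightarrow> ('o \<Rightarrow> 'm)
    \<Rightarrow> ('o \<times> 'm, ('o \<times> 'm) \<times> 'm \<times> ('o \<times> 'm)) cat" where
  "coalgebras M C \<delta> \<epsilon> =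
    \<lparr>Obj = {A. coalgebra M C \<delta> \<epsilon> A},
     Arr = {(A, f, B). coalgebra M C \<delta> \<epsilon> A \<and> coalgebra M C \<delta> \<epsilon> B \<and>
       f \<in> hom M (fst A) (fst B) \<and> snd B \<cdot>\<^bsub>M\<^esub> f = ar C f \<cdot>\<^bsub>M\<^esub> snd A},
     Dom = (\<lambda>(A, f, B). A),
     Cod = (\<lambda>(A, f, B). B),
     Id = (\<lambda>A. (A, Id M (fst A), A)),
     Comp = (\<lambda>(B, g, D) (A, f, B'). (A, g \<cdot>\<^bsub>M\<^esub> f, D))\<rparr>"

text \<open>The conjugate of a comonad \<^term>\<open>C\<close> on \<^term>\<open>M\<close> under an adjunction between
  \<^term>\<open>H\<close> and \<^term>\<open>K\<close> is the comonad on \<^term>\<open>N\<close> given by the next three definitions.\<close>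

definition conj_functor ::
  "('o, 'm, 'p, 'n) functor_data \<Rightarrow> ('p, 'n, 'o, 'm) functor_data \<Rightarrow> ('o, 'm, 'o, 'm) functor_data
    \<Rightarrow> ('p, 'n, 'p, 'n) functor_data" where
  "conj_functor H K C = H \<circ>\<^sub>F C \<circ>\<^sub>F K"

definition conj_comult ::
  "('p, 'n) cat \<Rightarrow> ('o, 'm, 'p, 'n) functor_data \<Rightarrow> ('p, 'n, 'o, 'm) functor_data \<Rightarrow> ('o \<Rightarrow> 'm)
    \<Rightarrow> ('o, 'm, 'o, 'm) functor_data \<Rightarrow> ('o \<Rightarrow> 'm) \<Rightarrow> 'p \<Rightarrow> 'n" where
  "conj_comult N H K \<eta> C \<delta> Y =
     ar H (ar C (\<eta> (ob C (ob K Y)))) \<cdot>\<^bsub>N\<^esub> ar H (\<delta> (ob K Y))"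

definition conj_counit ::
  "('p, 'n) cat \<Rightarrow> ('o, 'm, 'p, 'n) functor_data \<Rightarrow> ('p, 'n, 'o, 'm) functor_data \<Rightarrow> ('p \<Rightarrow> 'n)
    \<Rightarrow> ('o \<Rightarrow> 'm) \<Rightarrow> 'p \<Rightarrow> 'n" where
  "conj_counit N H K \<xi> \<epsilon> Y = \<xi> Y \<cdot>\<^bsub>N\<^esub> ar H (\<epsilon> (ob K Y))"

definition comparison_ob ::
  "('p, 'n) cat \<Rightarrow> ('o, 'm, 'p, 'n) functor_data \<Rightarrow> ('o \<Rightarrow> 'm) \<Rightarrow> ('o, 'm, 'o, 'm) functor_data
    \<Rightarrow> 'o \<times> 'm \<Rightarrow> 'p \<times> 'n" where
  "comparison_ob N H \<eta> C = (\<lambda>(X, c). (ob H X, ar H (ar C (\<eta> X)) \<cdot>\<^bsub>N\<^esub> ar H c))"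

definition comparison ::
  "('p, 'n) cat \<Rightarrow> ('o, 'm, 'p, 'n) functor_data \<Rightarrow> ('o \<Rightarrow> 'm) \<Rightarrow> ('o, 'm, 'o, 'm) functor_data
    \<Rightarrow> ('o \<times> 'm, ('o \<times> 'm) \<times> 'm \<times> ('o \<times> 'm), 'p \<times> 'n, ('p \<times> 'n) \<times> 'n \<times> ('p \<times> 'n)) functor_data"
  where
  "comparison N H \<eta> C =
    \<lparr>ob = comparison_ob N H \<eta> C,
     ar = (\<lambda>(A, f, B). (comparison_ob N H \<eta> C A, ar H f, comparison_ob N H \<eta> C B))\<rparr>"

end

theory Submission
  imports Defs
begin

text \<open>Everything reduces to one theorem of Beck: for an adjunction with left adjoint
  \<open>H : M \<rightarrow> N\<close> and right adjoint \<open>K\<close>, the canonical functor \<open>X \<mapsto> (H X, H \<eta>\<^sub>X)\<close> from \<open>M\<close> to the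
  coalgebras of the comonad \<open>H K\<close> is an equivalence if and only if \<open>M\<close> has, and \<open>H\<close> preserves,
  equalizers of coreflexive \<open>H\<close>-split pairs and \<open>H\<close> is conservative (lemmas
  \<open>beck_sufficient\<close> and \<open>beck_necessary\<close>).  The theorem is obtained by applying this to two
  different adjunctions.

  For a comonad \<open>C\<close> on \<open>M\<close>, compose the given adjunction with the one between the forgetful
  functor \<open>U : M\<^sub>C \<rightarrow> M\<close> and the cofree coalgebra functor.  The resulting adjunction between
  \<open>M\<^sub>C\<close> and \<open>N\<close> has left adjoint \<open>H U\<close>, it induces on \<open>N\<close> exactly the conjugate comonad of \<open>C\<close>,
  and its canonical functor is the comparison functor of \<open>C\<close> (\<open>comparison_equivalence\<close>).  So
  the latter is an equivalence as soon as \<open>H U\<close> satisfies Beck's conditions.  If \<open>H\<close> satisfies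
  them then so does \<open>H U\<close>, provided that \<open>C\<close> and \<open>C\<^sup>2\<close> preserve the relevant equalizers: these
  are then created by \<open>U\<close> (\<open>coalgebras_equalizer\<close>, \<open>beck_conditions_coalgebras\<close>).

  Conversely, the identity comonad preserves everything, so its comparison functor is an
  equivalence under the first condition of the theorem.  As \<open>M\<close> is equivalent to its
  category of coalgebras, the canonical functor of the given adjunction is an equivalence as
  well, and the other half of Beck's theorem gives the three conditions.

  Equivalences are handled throughout as fully faithful and essentially surjective functors.\<close>

section \<open>Composition calculus\<close>

lemma in_hom: "f \<in> hom C X Y \<longleftrightarrow> f \<in> Arr C \<and> Dom C f = X \<and> Cod C f = Y"
  by (simp add: hom_def)

lemma functor_simps [simp]:
  "ob id_functor X = X" "ar id_functor f = f"
  "ob (G \<circ>\<^sub>F F) X = ob G (ob F X)" "ar (G \<circ>\<^sub>F F) f = ar G (ar F f)"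
  by (simp_all add: id_functor_def comp_functor_def)

text \<open>Membership in a hom set mentions objects that a conditional rewrite rule cannot guess.
  The laws are therefore restated with \<^term>\<open>Dom\<close> and \<^term>\<open>Cod\<close>, which lets the simplifier
  compute all types and bring composites into a normal form.\<close>

context category
begin

declare Dom_in [simp] Cod_in [simp]

lemma Id_simps [simp]:
  assumes "X \<in> Obj C"
  shows "Id C X \<in> Arr C" "Dom C (Id C X) = X" "Cod C (Id C X) = X"
  using Id_hom[OF assms] by (simp_all add: in_hom)

lemma Comp_simps [simp]:
  assumes "f \<in> Arr C" "g \<in> Arr C" "Dom C g = Cod C f"
  shows "g \<cdot>\<^bsub>C\<^esub> f \<in> Arr C" "Dom C (g \<cdot>\<^bsub>C\<^esub> f) = Dom C f" "Cod C (g \<cdot>\<^bsub>C\<^esub> f) = Cod C g"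
  using Comp_hom[of f "Dom C f" "Cod C f" g "Cod C g"] assms by (simp_all add: in_hom)

lemma Comp_Id [simp]:
  "f \<in> Arr C \<Longrightarrow> Dom C f = X \<Longrightarrow> f \<cdot>\<^bsub>C\<^esub> Id C X = f"
  "f \<in> Arr C \<Longrightarrow> Cod C f = X \<Longrightarrow> Id C X \<cdot>\<^bsub>C\<^esub> f = f"
  using Id_right[of f X "Cod C f"] Id_left[of f "Dom C f" X] by (simp_all add: in_hom)

lemma Comp_assoc_Arr [simp]:
  assumes "f \<in> Arr C" "g \<in> Arr C" "h \<in> Arr C" "Dom C g = Cod C f" "Dom C h = Cod C g"
  shows "(h \<cdot>\<^bsub>C\<^esub> g) \<cdot>\<^bsub>C\<^esub> f = h \<cdot>\<^bsub>C\<^esub> (g \<cdot>\<^bsub>C\<^esub> f)"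
  using Comp_assoc[of f "Dom C f" "Cod C f" g "Cod C g" h "Cod C h"] assms by (simp add: in_hom)

text \<open>Composites are normalised by associating to the right, so an equation between composites
  only rewrites inside a longer composite in this form.\<close>

lemma extend:
  assumes "a \<cdot>\<^bsub>C\<^esub> b = c"
    and "x \<in> Arr C" "b \<in> Arr C" "a \<in> Arr C" "Dom C b = Cod C x" "Dom C a = Cod C b"
  shows "a \<cdot>\<^bsub>C\<^esub> (b \<cdot>\<^bsub>C\<^esub> x) = c \<cdot>\<^bsub>C\<^esub> x"
  using assms by (metis Comp_assoc_Arr)

end

lemma (in is_functor) ar_simps [simp]:
  assumes "f \<in> Arr A"
  shows "ar F f \<in> Arr B" "Dom B (ar F f) = ob F (Dom A f)" "Cod B (ar F f) = ob F (Cod A f)"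
  using ar_hom[of f "Dom A f" "Cod A f"] assms by (simp_all add: in_hom)

lemma (in is_functor) ar_Comp_Arr [simp]:
  assumes "f \<in> Arr A" "g \<in> Arr A" "Dom A g = Cod A f"
  shows "ar F (g \<cdot>\<^bsub>A\<^esub> f) = ar F g \<cdot>\<^bsub>B\<^esub> ar F f"
  using ar_Comp[of f "Dom A f" "Cod A f" g "Cod A g"] assms by (simp add: in_hom)

declare (in is_functor) ob_in [simp] ar_Id [simp]

lemma is_functor_comp:
  assumes "is_functor A B F" "is_functor B C G"
  shows "is_functor A C (G \<circ>\<^sub>F F)"
proof -
  interpret F: is_functor A B F by fact
  interpret G: is_functor B C G by fact
  show ?thesis
    by unfold_locales (auto simp: in_hom)
qed

lemma (in is_functor) ar_eq_Comp:
  assumes "g \<cdot>\<^bsub>A\<^esub> f = h" "f \<in> Arr A" "g \<in> Arr A" "Dom A g = Cod A f"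
  shows "ar F g \<cdot>\<^bsub>B\<^esub> ar F f = ar F h"
  using assms by (metis ar_Comp_Arr)

lemma (in nat_trans) component_simps [simp]:
  assumes "X \<in> Obj A"
  shows "\<tau> X \<in> Arr B" "Dom B (\<tau> X) = ob F X" "Cod B (\<tau> X) = ob G X"
  using component_hom[OF assms] by (simp_all add: in_hom)

lemma (in nat_trans) naturality_Arr:
  assumes "f \<in> Arr A" "Dom A f = X" "Cod A f = Y"
  shows "\<tau> Y \<cdot>\<^bsub>B\<^esub> ar F f = ar G f \<cdot>\<^bsub>B\<^esub> \<tau> X"
  using naturality[of f X Y] assms by (simp add: in_hom)

section \<open>Isomorphisms and equalizers\<close>

lemma is_isoI:
  assumes "f \<in> hom C X Y" "g \<in> hom C Y X" "g \<cdot>\<^bsub>C\<^esub> f = Id C X" "f \<cdot>\<^bsub>C\<^esub> g = Id C Y"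
  shows "is_iso C f"
  using assms by (auto simp: is_iso_def in_hom)

lemma is_isoE:
  assumes "is_iso C f" "f \<in> hom C X Y"
  obtains g where "g \<in> hom C Y X" "g \<cdot>\<^bsub>C\<^esub> f = Id C X" "f \<cdot>\<^bsub>C\<^esub> g = Id C Y"
  using assms by (auto simp: is_iso_def in_hom)

lemma (in category) is_iso_Comp:
  assumes "is_iso C f" "is_iso C g" "f \<in> hom C X Y" "g \<in> hom C Y Z"
  shows "is_iso C (g \<cdot>\<^bsub>C\<^esub> f)"
proof -
  obtain f' where f': "f' \<in> hom C Y X" "f' \<cdot>\<^bsub>C\<^esub> f = Id C X" "f \<cdot>\<^bsub>C\<^esub> f' = Id C Y"
    using assms is_isoE by metis
  obtain g' where g': "g' \<in> hom C Z Y" "g' \<cdot>\<^bsub>C\<^esub> g = Id C Y" "g \<cdot>\<^bsub>C\<^esub> g' = Id C Z"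
    using assms is_isoE by metis
  show ?thesis
  proof (rule is_isoI)
    show "g \<cdot>\<^bsub>C\<^esub> f \<in> hom C X Z" "f' \<cdot>\<^bsub>C\<^esub> g' \<in> hom C Z X"
      using assms f' g' Comp_hom by blast+
  qed (use assms f' g' extend[OF f'(3)] extend[OF g'(2)] in \<open>auto simp: in_hom\<close>)
qed

context category
begin

lemma is_iso_cancel_left:
  assumes "is_iso C a" "a \<in> hom C X Y" "k \<in> hom C Z X" "k' \<in> hom C Z X"
    and "a \<cdot>\<^bsub>C\<^esub> k = a \<cdot>\<^bsub>C\<^esub> k'"
  shows "k = k'"
proof -
  obtain b where b: "b \<in> hom C Y X" "b \<cdot>\<^bsub>C\<^esub> a = Id C X"
    using is_isoE[OF assms(1,2)] .
  have "b \<cdot>\<^bsub>C\<^esub> (a \<cdot>\<^bsub>C\<^esub> k) = k" "b \<cdot>\<^bsub>C\<^esub> (a \<cdot>\<^bsub>C\<^esub> k') = k'"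
    using b(1) assms(2-4) extend[OF b(2)] by (simp_all add: in_hom)
  then show ?thesis
    using assms(5) by metis
qed

lemma is_iso_cancel_right:
  assumes "is_iso C a" "a \<in> hom C X Y" "k \<in> hom C Y Z" "k' \<in> hom C Y Z"
    and "k \<cdot>\<^bsub>C\<^esub> a = k' \<cdot>\<^bsub>C\<^esub> a"
  shows "k = k'"
proof -
  obtain b where b: "b \<in> hom C Y X" "a \<cdot>\<^bsub>C\<^esub> b = Id C Y"
    using is_isoE[OF assms(1,2)] .
  have "(k \<cdot>\<^bsub>C\<^esub> a) \<cdot>\<^bsub>C\<^esub> b = k" "(k' \<cdot>\<^bsub>C\<^esub> a) \<cdot>\<^bsub>C\<^esub> b = k'"
    using b assms(2-4) by (simp_all add: in_hom)
  then show ?thesis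
    using assms(5) by metis
qed

end

lemma (in is_functor) preserves_iso:
  assumes "is_iso A f"
  shows "is_iso B (ar F f)"
proof -
  have f: "f \<in> hom A (Dom A f) (Cod A f)"
    using assms by (simp add: is_iso_def in_hom)
  obtain g where g: "g \<in> hom A (Cod A f) (Dom A f)" "g \<cdot>\<^bsub>A\<^esub> f = Id A (Dom A f)"
    "f \<cdot>\<^bsub>A\<^esub> g = Id A (Cod A f)"
    using is_isoE[OF assms f] .
  show ?thesis
    by (rule is_isoI[OF ar_hom[OF f] ar_hom[OF g(1)]])
      (use f g ar_eq_Comp[OF g(2)] ar_eq_Comp[OF g(3)] in \<open>auto simp: in_hom\<close>)
qed

lemma is_equalizerI:
  assumes "e \<in> hom C E X" "f \<in> hom C X Y" "g \<in> hom C X Y" "f \<cdot>\<^bsub>C\<^esub> e = g \<cdot>\<^bsub>C\<^esub> e"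
    and "\<And>Z h. h \<in> hom C Z X \<Longrightarrow> f \<cdot>\<^bsub>C\<^esub> h = g \<cdot>\<^bsub>C\<^esub> h \<Longrightarrow> \<exists>k \<in> hom C Z E. e \<cdot>\<^bsub>C\<^esub> k = h"
    and "\<And>Z k k'. k \<in> hom C Z E \<Longrightarrow> k' \<in> hom C Z E \<Longrightarrow> e \<cdot>\<^bsub>C\<^esub> k = e \<cdot>\<^bsub>C\<^esub> k' \<Longrightarrow> k = k'"
  shows "is_equalizer C e f g"
  unfolding is_equalizer_def using assms by metis

lemma is_equalizerD:
  assumes "is_equalizer C e f g"
  shows "e \<in> hom C (Dom C e) (Cod C e)" "f \<in> hom C (Cod C e) (Cod C f)"
    "g \<in> hom C (Cod C e) (Cod C f)" "f \<cdot>\<^bsub>C\<^esub> e = g \<cdot>\<^bsub>C\<^esub> e"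
  using assms by (auto simp: is_equalizer_def in_hom)

lemma is_equalizer_factor:
  assumes "is_equalizer C e f g" "e \<in> hom C E X" "h \<in> hom C Z X" "f \<cdot>\<^bsub>C\<^esub> h = g \<cdot>\<^bsub>C\<^esub> h"
  obtains k where "k \<in> hom C Z E" "e \<cdot>\<^bsub>C\<^esub> k = h"
  using assms unfolding is_equalizer_def by (metis in_hom)

context category
begin

lemma is_equalizer_mono:
  assumes "is_equalizer C e f g" "e \<in> hom C E X" "k \<in> hom C Z E" "k' \<in> hom C Z E"
    and "e \<cdot>\<^bsub>C\<^esub> k = e \<cdot>\<^bsub>C\<^esub> k'"
  shows "k = k'"
proof -
  have ek: "e \<cdot>\<^bsub>C\<^esub> k \<in> hom C Z X"
    using assms(2,3) Comp_hom by blast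
  have "f \<cdot>\<^bsub>C\<^esub> (e \<cdot>\<^bsub>C\<^esub> k) = g \<cdot>\<^bsub>C\<^esub> (e \<cdot>\<^bsub>C\<^esub> k)"
    using is_equalizerD[OF assms(1)] assms(2,3) extend[OF is_equalizerD(4)[OF assms(1)], of k]
    by (simp add: in_hom)
  then have "\<exists>!u. u \<in> hom C Z E \<and> e \<cdot>\<^bsub>C\<^esub> u = e \<cdot>\<^bsub>C\<^esub> k"
    using assms(1,2) ek unfolding is_equalizer_def by (metis in_hom)
  then show ?thesis
    using assms(3-5) by metis
qed

text \<open>A split cofork is an equalizer because the section \<open>q\<close> already produces the
  factorisation: if \<open>f h = g h\<close> then \<open>h = q f h = q g h = e (p h)\<close>.\<close>

lemma split_cofork_is_equalizer:
  assumes "split_cofork C e f g"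
  shows "is_equalizer C e f g"
proof -
  obtain E X Y p q where e: "e \<in> hom C E X" "f \<in> hom C X Y" "g \<in> hom C X Y"
    "f \<cdot>\<^bsub>C\<^esub> e = g \<cdot>\<^bsub>C\<^esub> e" "p \<in> hom C X E" "q \<in> hom C Y X"
    "p \<cdot>\<^bsub>C\<^esub> e = Id C E" "q \<cdot>\<^bsub>C\<^esub> f = Id C X" "e \<cdot>\<^bsub>C\<^esub> p = q \<cdot>\<^bsub>C\<^esub> g"
    using assms unfolding split_cofork_def by blast
  show ?thesis
  proof (rule is_equalizerI[OF e(1-4)])
    fix Z h
    assume h: "h \<in> hom C Z X" "f \<cdot>\<^bsub>C\<^esub> h = g \<cdot>\<^bsub>C\<^esub> h"
    have "e \<cdot>\<^bsub>C\<^esub> (p \<cdot>\<^bsub>C\<^esub> h) = h"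
      using e h extend[OF e(9), of h] extend[OF e(8), of h] by (simp add: in_hom)
    moreover have "p \<cdot>\<^bsub>C\<^esub> h \<in> hom C Z E"
      using e h Comp_hom by blast
    ultimately show "\<exists>k \<in> hom C Z E. e \<cdot>\<^bsub>C\<^esub> k = h"
      by blast
  next
    fix Z k k'
    assume k: "k \<in> hom C Z E" "k' \<in> hom C Z E" "e \<cdot>\<^bsub>C\<^esub> k = e \<cdot>\<^bsub>C\<^esub> k'"
    have "p \<cdot>\<^bsub>C\<^esub> (e \<cdot>\<^bsub>C\<^esub> k) = k" "p \<cdot>\<^bsub>C\<^esub> (e \<cdot>\<^bsub>C\<^esub> k') = k'"
      using e(1-5) k(1,2) extend[OF e(7)] by (simp_all add: in_hom)
    then show "k = k'"
      using k(3) by metis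
  qed
qed

text \<open>Equalizers of the same pair factor through each other, and the two factorisations are
  mutually inverse because equalizers are monic.\<close>

lemma equalizers_factor_iso:
  assumes "is_equalizer C e f g" "is_equalizer C e' f g"
    and "e \<in> hom C E X" "e' \<in> hom C E' X" "k \<in> hom C E' E" "e \<cdot>\<^bsub>C\<^esub> k = e'"
  shows "is_iso C k"
proof -
  obtain k' where k': "k' \<in> hom C E E'" "e' \<cdot>\<^bsub>C\<^esub> k' = e"
    using is_equalizer_factor[OF assms(2,4,3) is_equalizerD(4)[OF assms(1)]] .
  show ?thesis
  proof (rule is_isoI[OF assms(5) k'(1)])
    have "k' \<cdot>\<^bsub>C\<^esub> k \<in> hom C E' E'" "Id C E' \<in> hom C E' E'"
      using assms(4,5) k'(1) by (auto simp: in_hom)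
    moreover have "e' \<cdot>\<^bsub>C\<^esub> (k' \<cdot>\<^bsub>C\<^esub> k) = e' \<cdot>\<^bsub>C\<^esub> Id C E'"
      using assms(3-6) k'(1) extend[OF k'(2)] by (simp add: in_hom)
    ultimately show "k' \<cdot>\<^bsub>C\<^esub> k = Id C E'"
      by (rule is_equalizer_mono[OF assms(2,4)])
    have "k \<cdot>\<^bsub>C\<^esub> k' \<in> hom C E E" "Id C E \<in> hom C E E"
      using assms(3,5) k'(1) by (auto simp: in_hom)
    moreover have "e \<cdot>\<^bsub>C\<^esub> (k \<cdot>\<^bsub>C\<^esub> k') = e \<cdot>\<^bsub>C\<^esub> Id C E"
      using assms(3-5) k' extend[OF assms(6)] by (simp add: in_hom)
    ultimately show "k \<cdot>\<^bsub>C\<^esub> k' = Id C E"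
      by (rule is_equalizer_mono[OF assms(1,3)])
  qed
qed

lemma equalizers_iso:
  assumes "is_equalizer C e f g" "is_equalizer C e' f g"
    and "e \<in> hom C E X" "e' \<in> hom C E' X"
  obtains k where "k \<in> hom C E' E" "e \<cdot>\<^bsub>C\<^esub> k = e'" "is_iso C k"
proof -
  obtain k where k: "k \<in> hom C E' E" "e \<cdot>\<^bsub>C\<^esub> k = e'"
    using is_equalizer_factor[OF assms(1,3,4) is_equalizerD(4)[OF assms(2)]] .
  show thesis
    by (rule that[OF k equalizers_factor_iso[OF assms k]])
qed

lemma is_equalizer_Comp_iso:
  assumes "is_equalizer C e f g" "is_iso C k" "e \<in> hom C E X" "k \<in> hom C E' E"
  shows "is_equalizer C (e \<cdot>\<^bsub>C\<^esub> k) f g"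
proof -
  obtain k' where k': "k' \<in> hom C E E'" "k' \<cdot>\<^bsub>C\<^esub> k = Id C E'" "k \<cdot>\<^bsub>C\<^esub> k' = Id C E"
    using is_isoE[OF assms(2,4)] .
  note d = is_equalizerD[OF assms(1)]
  have X: "Cod C e = X"
    using assms(3) by (simp add: in_hom)
  show ?thesis
  proof (rule is_equalizerI)
    show "e \<cdot>\<^bsub>C\<^esub> k \<in> hom C E' X"
      using assms Comp_hom by blast
    show "f \<in> hom C X (Cod C f)" "g \<in> hom C X (Cod C f)"
      using d X by auto
    show "f \<cdot>\<^bsub>C\<^esub> (e \<cdot>\<^bsub>C\<^esub> k) = g \<cdot>\<^bsub>C\<^esub> (e \<cdot>\<^bsub>C\<^esub> k)"
      using d assms(3,4) extend[OF d(4), of k] by (simp add: in_hom)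
  next
    fix Z h
    assume h: "h \<in> hom C Z X" "f \<cdot>\<^bsub>C\<^esub> h = g \<cdot>\<^bsub>C\<^esub> h"
    obtain u where u: "u \<in> hom C Z E" "e \<cdot>\<^bsub>C\<^esub> u = h"
      using is_equalizer_factor[OF assms(1,3) h] .
    have "(e \<cdot>\<^bsub>C\<^esub> k) \<cdot>\<^bsub>C\<^esub> (k' \<cdot>\<^bsub>C\<^esub> u) = h"
      using u k' assms(3,4) extend[OF k'(3), of u] by (simp add: in_hom)
    moreover have "k' \<cdot>\<^bsub>C\<^esub> u \<in> hom C Z E'"
      using u k' Comp_hom by blast
    ultimately show "\<exists>v \<in> hom C Z E'. (e \<cdot>\<^bsub>C\<^esub> k) \<cdot>\<^bsub>C\<^esub> v = h"
      by blast
  next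
    fix Z u v
    assume u: "u \<in> hom C Z E'" "v \<in> hom C Z E'" "(e \<cdot>\<^bsub>C\<^esub> k) \<cdot>\<^bsub>C\<^esub> u = (e \<cdot>\<^bsub>C\<^esub> k) \<cdot>\<^bsub>C\<^esub> v"
    have "k \<cdot>\<^bsub>C\<^esub> u \<in> hom C Z E" "k \<cdot>\<^bsub>C\<^esub> v \<in> hom C Z E"
      using u assms Comp_hom by blast+
    moreover have "e \<cdot>\<^bsub>C\<^esub> (k \<cdot>\<^bsub>C\<^esub> u) = e \<cdot>\<^bsub>C\<^esub> (k \<cdot>\<^bsub>C\<^esub> v)"
      using u assms by (simp add: in_hom)
    ultimately have "k \<cdot>\<^bsub>C\<^esub> u = k \<cdot>\<^bsub>C\<^esub> v"
      by (rule is_equalizer_mono[OF assms(1,3)])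
    moreover have "k' \<cdot>\<^bsub>C\<^esub> (k \<cdot>\<^bsub>C\<^esub> u) = u" "k' \<cdot>\<^bsub>C\<^esub> (k \<cdot>\<^bsub>C\<^esub> v) = v"
      using u(1,2) k'(1) assms(4) extend[OF k'(2)] by (simp_all add: in_hom)
    ultimately show "u = v"
      by metis
  qed
qed

end

section \<open>Equivalences as fully faithful, essentially surjective functors\<close>

definition fully_faithful where
  "fully_faithful A B F \<longleftrightarrow>
     (\<forall>X \<in> Obj A. \<forall>Y \<in> Obj A. bij_betw (ar F) (hom A X Y) (hom B (ob F X) (ob F Y)))"

definition essentially_surjective where
  "essentially_surjective A B F \<longleftrightarrow>
     (\<forall>Y \<in> Obj B. \<exists>X \<in> Obj A. \<exists>i \<in> hom B (ob F X) Y. is_iso B i)"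

lemma fully_faithful_inj:
  assumes "fully_faithful A B F" "X \<in> Obj A" "Y \<in> Obj A"
    and "k \<in> hom A X Y" "k' \<in> hom A X Y" "ar F k = ar F k'"
  shows "k = k'"
  using assms unfolding fully_faithful_def bij_betw_def inj_on_def by blast

lemma fully_faithful_surj:
  assumes "fully_faithful A B F" "X \<in> Obj A" "Y \<in> Obj A" "h \<in> hom B (ob F X) (ob F Y)"
  shows "\<exists>k \<in> hom A X Y. ar F k = h"
  using assms unfolding fully_faithful_def by (metis bij_betw_imp_surj_on image_iff)

context is_functor
begin

lemma fully_faithfulI:
  assumes "\<And>X Y k k'. \<lbrakk>X \<in> Obj A; Y \<in> Obj A; k \<in> hom A X Y; k' \<in> hom A X Y; ar F k = ar F k'\<rbrakk>
      \<Longrightarrow> k = k'"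
    and "\<And>X Y h. \<lbrakk>X \<in> Obj A; Y \<in> Obj A; h \<in> hom B (ob F X) (ob F Y)\<rbrakk>
      \<Longrightarrow> \<exists>k \<in> hom A X Y. ar F k = h"
  shows "fully_faithful A B F"
  unfolding fully_faithful_def bij_betw_def inj_on_def image_def
  using assms ar_hom by (intro ballI conjI) blast+

lemma fully_faithful_reflects_iso:
  assumes ff: "fully_faithful A B F" and f: "f \<in> Arr A" and iso: "is_iso B (ar F f)"
  shows "is_iso A f"
proof -
  let ?X = "Dom A f" and ?Y = "Cod A f"
  have fh: "f \<in> hom A ?X ?Y"
    using f by (simp add: in_hom)
  obtain h where h: "h \<in> hom B (ob F ?Y) (ob F ?X)" "h \<cdot>\<^bsub>B\<^esub> ar F f = Id B (ob F ?X)"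
    "ar F f \<cdot>\<^bsub>B\<^esub> h = Id B (ob F ?Y)"
    using is_isoE[OF iso ar_hom[OF fh]] .
  obtain g where g: "g \<in> hom A ?Y ?X" "ar F g = h"
    using fully_faithful_surj[OF ff] h(1) f by force
  have g': "g \<in> Arr A" "Dom A g = ?Y" "Cod A g = ?X"
    using g by (auto simp: in_hom)
  show ?thesis
  proof (rule is_isoI[OF fh g(1)])
    show "g \<cdot>\<^bsub>A\<^esub> f = Id A ?X"
      by (rule fully_faithful_inj[OF ff, of ?X ?X]) (use f g g' h in \<open>auto simp: in_hom\<close>)
    show "f \<cdot>\<^bsub>A\<^esub> g = Id A ?Y"
      by (rule fully_faithful_inj[OF ff, of ?Y ?Y]) (use f g g' h in \<open>auto simp: in_hom\<close>)
  qed
qed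

lemma is_equivalenceI:
  assumes ff: "fully_faithful A B F" and es: "essentially_surjective A B F"
  shows "is_equivalence A B F"
proof -
  have "\<forall>Y \<in> Obj B. \<exists>X i j. X \<in> Obj A \<and> i \<in> hom B (ob F X) Y \<and> j \<in> hom B Y (ob F X) \<and>
    j \<cdot>\<^bsub>B\<^esub> i = Id B (ob F X) \<and> i \<cdot>\<^bsub>B\<^esub> j = Id B Y"
  proof
    fix Y assume "Y \<in> Obj B"
    then obtain X i where X: "X \<in> Obj A" "i \<in> hom B (ob F X) Y" "is_iso B i"
      using es unfolding essentially_surjective_def by blast
    obtain j where "j \<in> hom B Y (ob F X)" "j \<cdot>\<^bsub>B\<^esub> i = Id B (ob F X)" "i \<cdot>\<^bsub>B\<^esub> j = Id B Y"
      using is_isoE[OF X(3,2)] .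
    with X(1,2) show "\<exists>X i j. X \<in> Obj A \<and> i \<in> hom B (ob F X) Y \<and> j \<in> hom B Y (ob F X) \<and>
      j \<cdot>\<^bsub>B\<^esub> i = Id B (ob F X) \<and> i \<cdot>\<^bsub>B\<^esub> j = Id B Y"
      by blast
  qed
  then obtain O' \<beta> \<gamma> where "\<forall>Y \<in> Obj B. O' Y \<in> Obj A \<and> \<beta> Y \<in> hom B (ob F (O' Y)) Y \<and>
    \<gamma> Y \<in> hom B Y (ob F (O' Y)) \<and>
    \<gamma> Y \<cdot>\<^bsub>B\<^esub> \<beta> Y = Id B (ob F (O' Y)) \<and> \<beta> Y \<cdot>\<^bsub>B\<^esub> \<gamma> Y = Id B Y"
    by metis
  then have O' [simp]: "\<And>Y. Y \<in> Obj B \<Longrightarrow> O' Y \<in> Obj A"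
    and \<beta> [simp]: "\<And>Y. Y \<in> Obj B \<Longrightarrow> \<beta> Y \<in> Arr B"
      "\<And>Y. Y \<in> Obj B \<Longrightarrow> Dom B (\<beta> Y) = ob F (O' Y)" "\<And>Y. Y \<in> Obj B \<Longrightarrow> Cod B (\<beta> Y) = Y"
    and \<gamma> [simp]: "\<And>Y. Y \<in> Obj B \<Longrightarrow> \<gamma> Y \<in> Arr B"
      "\<And>Y. Y \<in> Obj B \<Longrightarrow> Cod B (\<gamma> Y) = ob F (O' Y)" "\<And>Y. Y \<in> Obj B \<Longrightarrow> Dom B (\<gamma> Y) = Y"
    and \<gamma>\<beta> [simp]: "\<And>Y. Y \<in> Obj B \<Longrightarrow> \<gamma> Y \<cdot>\<^bsub>B\<^esub> \<beta> Y = Id B (ob F (O' Y))"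
    and \<beta>\<gamma> [simp]: "\<And>Y. Y \<in> Obj B \<Longrightarrow> \<beta> Y \<cdot>\<^bsub>B\<^esub> \<gamma> Y = Id B Y"
    by (auto simp: in_hom)
  \<comment> \<open>The inverse functor takes \<open>g\<close> to the unique preimage of \<open>g\<close> conjugated by the isomorphisms
    \<open>\<beta>\<close>; then \<open>\<beta>\<close> is natural by construction.\<close>
  define conjugate where "conjugate g = \<gamma> (Cod B g) \<cdot>\<^bsub>B\<^esub> (g \<cdot>\<^bsub>B\<^esub> \<beta> (Dom B g))" for g
  have "\<forall>g \<in> Arr B. \<exists>k. k \<in> hom A (O' (Dom B g)) (O' (Cod B g)) \<and> ar F k = conjugate g"
  proof
    fix g assume g: "g \<in> Arr B"
    have "conjugate g \<in> hom B (ob F (O' (Dom B g))) (ob F (O' (Cod B g)))"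
      using g by (simp add: conjugate_def in_hom)
    then show "\<exists>k. k \<in> hom A (O' (Dom B g)) (O' (Cod B g)) \<and> ar F k = conjugate g"
      using fully_faithful_surj[OF ff, of "O' (Dom B g)" "O' (Cod B g)"] g by auto
  qed
  then obtain a where "\<forall>g \<in> Arr B. a g \<in> hom A (O' (Dom B g)) (O' (Cod B g)) \<and> ar F (a g) = conjugate g"
    by metis
  then have a [simp]: "\<And>g. g \<in> Arr B \<Longrightarrow> a g \<in> Arr A"
    "\<And>g. g \<in> Arr B \<Longrightarrow> Dom A (a g) = O' (Dom B g)"
    "\<And>g. g \<in> Arr B \<Longrightarrow> Cod A (a g) = O' (Cod B g)"
    and Fa: "\<And>g. g \<in> Arr B \<Longrightarrow> ar F (a g) = conjugate g"
    by (auto simp: in_hom)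
  have cancel [simp]: "\<beta> Y \<cdot>\<^bsub>B\<^esub> (\<gamma> Y \<cdot>\<^bsub>B\<^esub> h) = h" if "Y \<in> Obj B" "h \<in> Arr B" "Cod B h = Y" for Y h
    using that B.extend[OF \<beta>\<gamma>[OF that(1)] that(2)] by simp
  have cancel' [simp]: "\<gamma> Y \<cdot>\<^bsub>B\<^esub> (\<beta> Y \<cdot>\<^bsub>B\<^esub> h) = h"
    if "Y \<in> Obj B" "h \<in> Arr B" "Cod B h = ob F (O' Y)" for Y h
    using that B.extend[OF \<gamma>\<beta>[OF that(1)] that(2)] by simp
  define G where "G = \<lparr>ob = O', ar = a\<rparr>"
  have [simp]: "ob G = O'" "ar G = a"
    by (simp_all add: G_def)
  interpret G: is_functor B A G
  proof
    fix Y assume Y: "Y \<in> Obj B"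
    show "ar G (Id B Y) = Id A (ob G Y)"
      by (rule fully_faithful_inj[OF ff, of "O' Y" "O' Y"])
        (use Y in \<open>auto simp: in_hom Fa conjugate_def\<close>)
  next
    fix f g X Y Z assume "f \<in> hom B X Y" "g \<in> hom B Y Z"
    then show "ar G (g \<cdot>\<^bsub>B\<^esub> f) = ar G g \<cdot>\<^bsub>A\<^esub> ar G f"
      by (intro fully_faithful_inj[OF ff, of "O' X" "O' Z"])
        (auto simp: in_hom Fa conjugate_def)
  qed (auto simp: in_hom)
  have [simp]: "a (Id B Y) = Id A (O' Y)" if "Y \<in> Obj B" for Y
    using G.ar_Id[OF that] by simp
  have [simp]: "a (g \<cdot>\<^bsub>B\<^esub> f) = a g \<cdot>\<^bsub>A\<^esub> a f"
    if "f \<in> Arr B" "g \<in> Arr B" "Dom B g = Cod B f" for f g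
    using G.ar_Comp_Arr[OF that] by simp
  have "nat_iso B B (F \<circ>\<^sub>F G) id_functor \<beta>"
  proof unfold_locales
    fix Y assume "Y \<in> Obj B"
    then show "is_iso B (\<beta> Y)"
      by (intro is_isoI[of _ _ "ob F (O' Y)" Y "\<gamma> Y"]) (auto simp: in_hom)
  qed (auto simp: in_hom Fa conjugate_def)
  moreover
  \<comment> \<open>The other natural isomorphism is the preimage of the inverse of \<open>\<beta>\<close>, so that its
    naturality and invertibility may be checked after applying \<open>F\<close>.\<close>
  have "\<forall>X \<in> Obj A. \<exists>k. k \<in> hom A X (O' (ob F X)) \<and> ar F k = \<gamma> (ob F X)"
  proof
    fix X assume "X \<in> Obj A"
    then show "\<exists>k. k \<in> hom A X (O' (ob F X)) \<and> ar F k = \<gamma> (ob F X)"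
      using fully_faithful_surj[OF ff, of X "O' (ob F X)" "\<gamma> (ob F X)"] by (auto simp: in_hom)
  qed
  then obtain \<alpha> where "\<forall>X \<in> Obj A. \<alpha> X \<in> hom A X (O' (ob F X)) \<and> ar F (\<alpha> X) = \<gamma> (ob F X)"
    by metis
  then have \<alpha> [simp]: "\<And>X. X \<in> Obj A \<Longrightarrow> \<alpha> X \<in> Arr A" "\<And>X. X \<in> Obj A \<Longrightarrow> Dom A (\<alpha> X) = X"
    "\<And>X. X \<in> Obj A \<Longrightarrow> Cod A (\<alpha> X) = O' (ob F X)"
    and F\<alpha>: "\<And>X. X \<in> Obj A \<Longrightarrow> ar F (\<alpha> X) = \<gamma> (ob F X)"
    by (auto simp: in_hom)
  have "nat_iso A A id_functor (G \<circ>\<^sub>F F) \<alpha>"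
  proof unfold_locales
    fix f X Y assume "f \<in> hom A X Y"
    then show "\<alpha> Y \<cdot>\<^bsub>A\<^esub> ar id_functor f = ar (G \<circ>\<^sub>F F) f \<cdot>\<^bsub>A\<^esub> \<alpha> X"
      by (intro fully_faithful_inj[OF ff, of X "O' (ob F Y)"])
        (auto simp: in_hom Fa F\<alpha> conjugate_def)
  next
    fix X assume X: "X \<in> Obj A"
    have "is_iso B (\<gamma> (ob F X))"
      using X by (intro is_isoI[of _ _ "ob F X" "ob F (O' (ob F X))" "\<beta> (ob F X)"])
        (auto simp: in_hom)
    then show "is_iso A (\<alpha> X)"
      using X fully_faithful_reflects_iso[OF ff] F\<alpha> by simp
  qed (auto simp: in_hom)
  ultimately show ?thesis
    unfolding is_equivalence_def using is_functor_axioms G.is_functor_axioms by blast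
qed

end

text \<open>\<open>F\<close> is faithful since \<open>G F\<close> is isomorphic to the identity, and \<open>G\<close> is faithful since \<open>F G\<close>
  is.  Fullness of \<open>F\<close> then follows from faithfulness of \<open>G\<close>: a morphism \<open>h\<close> between images
  of \<open>F\<close> is compared after applying \<open>G\<close> with the image of \<open>\<alpha>\<^sub>Y\<inverse> (G h) \<alpha>\<^sub>X\<close>.\<close>

lemma is_equivalenceD:
  assumes "is_equivalence A B F"
  shows is_equivalence_fully_faithful: "fully_faithful A B F"
    and is_equivalence_essentially_surjective: "essentially_surjective A B F"
proof -
  obtain G \<alpha> \<beta> where FG: "is_functor A B F" "is_functor B A G"
    and \<alpha>: "nat_iso A A id_functor (G \<circ>\<^sub>F F) \<alpha>" and \<beta>: "nat_iso B B (F \<circ>\<^sub>F G) id_functor \<beta>"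
    using assms unfolding is_equivalence_def by blast
  interpret F: is_functor A B F by fact
  interpret G: is_functor B A G by fact
  interpret \<alpha>: nat_iso A A id_functor "G \<circ>\<^sub>F F" \<alpha> by fact
  interpret \<beta>: nat_iso B B "F \<circ>\<^sub>F G" id_functor \<beta> by fact
  have F_inj: "k = k'"
    if Y: "Y \<in> Obj A" and k: "k \<in> hom A X Y" "k' \<in> hom A X Y" "ar F k = ar F k'" for k k' X Y
  proof (rule F.A.is_iso_cancel_left[OF \<alpha>.component_iso[OF Y] \<alpha>.component_hom[OF Y]])
    show "\<alpha> Y \<cdot>\<^bsub>A\<^esub> k = \<alpha> Y \<cdot>\<^bsub>A\<^esub> k'"
      using \<alpha>.naturality[OF k(1)] \<alpha>.naturality[OF k(2)] k(3) by simp
  qed (use k in simp_all)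
  have G_inj: "k = k'"
    if X: "X \<in> Obj B" and k: "k \<in> hom B X Y" "k' \<in> hom B X Y" "ar G k = ar G k'" for k k' X Y
  proof (rule F.B.is_iso_cancel_right[OF \<beta>.component_iso[OF X] \<beta>.component_hom[OF X]])
    show "k \<cdot>\<^bsub>B\<^esub> \<beta> X = k' \<cdot>\<^bsub>B\<^esub> \<beta> X"
      using \<beta>.naturality[OF k(1)] \<beta>.naturality[OF k(2)] k(3) by simp
  qed (use k in simp_all)
  have F_surj: "\<exists>k \<in> hom A X Y. ar F k = h"
    if X: "X \<in> Obj A" and Y: "Y \<in> Obj A" and h: "h \<in> hom B (ob F X) (ob F Y)" for X Y h
  proof -
    obtain j where j: "j \<in> hom A (ob G (ob F Y)) Y" "\<alpha> Y \<cdot>\<^bsub>A\<^esub> j = Id A (ob G (ob F Y))"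
      using is_isoE[OF \<alpha>.component_iso[OF Y] \<alpha>.component_hom[OF Y]] by auto
    define k where "k = j \<cdot>\<^bsub>A\<^esub> (ar G h \<cdot>\<^bsub>A\<^esub> \<alpha> X)"
    have k: "k \<in> hom A X Y"
      using X h j by (simp add: k_def in_hom)
    have "ar G (ar F k) = ar G h"
    proof (rule F.A.is_iso_cancel_right[OF \<alpha>.component_iso[OF X] \<alpha>.component_hom[OF X]])
      have "ar G (ar F k) \<cdot>\<^bsub>A\<^esub> \<alpha> X = \<alpha> Y \<cdot>\<^bsub>A\<^esub> k"
        using \<alpha>.naturality[OF k] by simp
      also have "\<dots> = ar G h \<cdot>\<^bsub>A\<^esub> \<alpha> X"
        using X Y h j(1) F.A.extend[OF j(2)] by (simp add: k_def in_hom)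
      finally show "ar G (ar F k) \<cdot>\<^bsub>A\<^esub> \<alpha> X = ar G h \<cdot>\<^bsub>A\<^esub> \<alpha> X" .
    qed (use X Y h k in \<open>simp_all add: in_hom\<close>)
    then have "ar F k = h"
      using G_inj[OF F.ob_in[OF X] F.ar_hom[OF k] h] by blast
    then show ?thesis
      using k by blast
  qed
  show "fully_faithful A B F"
    using F.fully_faithfulI F_inj F_surj by blast
  show "essentially_surjective A B F"
    unfolding essentially_surjective_def
    using G.ob_in \<beta>.component_hom \<beta>.component_iso by fastforce
qed

lemma is_equivalence_comp:
  assumes F: "is_equivalence A B F" and G: "is_equivalence B C G"
  shows "is_equivalence A C (G \<circ>\<^sub>F F)"
proof -
  interpret F: is_functor A B F using F by (simp add: is_equivalence_def)
  interpret G: is_functor B C G using G by (simp add: is_equivalence_def)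
  interpret GF: is_functor A C "G \<circ>\<^sub>F F"
    by (rule is_functor_comp[OF F.is_functor_axioms G.is_functor_axioms])
  show ?thesis
  proof (rule GF.is_equivalenceI)
    have "bij_betw (ar G \<circ> ar F) (hom A X Y) (hom C (ob G (ob F X)) (ob G (ob F Y)))"
      if "X \<in> Obj A" "Y \<in> Obj A" for X Y
      using that F.ob_in is_equivalence_fully_faithful[OF F] is_equivalence_fully_faithful[OF G]
      unfolding fully_faithful_def by (blast intro: bij_betw_trans)
    then show "fully_faithful A C (G \<circ>\<^sub>F F)"
      by (simp add: fully_faithful_def comp_functor_def comp_def)
    show "essentially_surjective A C (G \<circ>\<^sub>F F)"
      unfolding essentially_surjective_def
    proof
      fix Z assume "Z \<in> Obj C"
      then obtain Y i where Y: "Y \<in> Obj B" "i \<in> hom C (ob G Y) Z" "is_iso C i"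
        using is_equivalence_essentially_surjective[OF G] unfolding essentially_surjective_def by blast
      then obtain X j where X: "X \<in> Obj A" "j \<in> hom B (ob F X) Y" "is_iso B j"
        using is_equivalence_essentially_surjective[OF F] unfolding essentially_surjective_def by blast
      have "is_iso C (i \<cdot>\<^bsub>C\<^esub> ar G j)" "i \<cdot>\<^bsub>C\<^esub> ar G j \<in> hom C (ob G (ob F X)) Z"
        using G.B.is_iso_Comp[OF G.preserves_iso[OF X(3)] Y(3) G.ar_hom[OF X(2)] Y(2)]
          G.B.Comp_hom[OF G.ar_hom[OF X(2)] Y(2)] by simp_all
      then show "\<exists>X \<in> Obj A. \<exists>i \<in> hom C (ob (G \<circ>\<^sub>F F) X) Z. is_iso C i"
        using X(1) by auto
    qed
  qed
qed

lemma is_equivalence_cong: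
  assumes F: "is_equivalence A B F"
    and ob_eq: "\<And>X. X \<in> Obj A \<Longrightarrow> ob F X = ob F' X"
    and ar_eq: "\<And>f. f \<in> Arr A \<Longrightarrow> ar F f = ar F' f"
  shows "is_equivalence A B F'"
proof -
  interpret F: is_functor A B F using F by (simp add: is_equivalence_def)
  have hom_eq: "ar F f = ar F' f" if "f \<in> hom A X Y" for f X Y
    using that ar_eq by (simp add: in_hom)
  interpret F': is_functor A B F'
  proof
    show "ob F' X \<in> Obj B" if "X \<in> Obj A" for X
      using that F.ob_in ob_eq by metis
    show "ar F' f \<in> hom B (ob F' X) (ob F' Y)" if "f \<in> hom A X Y" for f X Y
      using F.ar_hom[OF that] hom_eq[OF that] that ob_eq[of X] ob_eq[of Y] F.A.Dom_in F.A.Cod_in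
      by (auto simp: in_hom)
    show "ar F' (Id A X) = Id B (ob F' X)" if "X \<in> Obj A" for X
      using that F.ar_Id ob_eq ar_eq F.A.Id_simps(1) by metis
    show "ar F' (g \<cdot>\<^bsub>A\<^esub> f) = ar F' g \<cdot>\<^bsub>B\<^esub> ar F' f" if "f \<in> hom A X Y" "g \<in> hom A Y Z" for f g X Y Z
      using that F.ar_Comp hom_eq F.A.Comp_hom by metis
  qed
  show ?thesis
  proof (rule F'.is_equivalenceI)
    have "bij_betw (ar F') (hom A X Y) (hom B (ob F' X) (ob F' Y))"
      if XY: "X \<in> Obj A" "Y \<in> Obj A" for X Y
    proof -
      have "bij_betw (ar F) (hom A X Y) (hom B (ob F X) (ob F Y))"
        using XY is_equivalence_fully_faithful[OF F] unfolding fully_faithful_def by blast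
      moreover have "bij_betw (ar F) (hom A X Y) S = bij_betw (ar F') (hom A X Y) S" for S
        by (rule bij_betw_cong) (rule hom_eq)
      ultimately show ?thesis
        using XY ob_eq by simp
    qed
    then show "fully_faithful A B F'"
      unfolding fully_faithful_def by blast
    show "essentially_surjective A B F'"
      using is_equivalence_essentially_surjective[OF F] ob_eq
      unfolding essentially_surjective_def by metis
  qed
qed

section \<open>Coalgebras\<close>

lemma coalgebraD:
  assumes "coalgebra M C \<delta> \<epsilon> P"
  shows "fst P \<in> Obj M" "snd P \<in> Arr M" "Dom M (snd P) = fst P" "Cod M (snd P) = ob C (fst P)"
    "\<delta> (fst P) \<cdot>\<^bsub>M\<^esub> snd P = ar C (snd P) \<cdot>\<^bsub>M\<^esub> snd P" "\<epsilon> (fst P) \<cdot>\<^bsub>M\<^esub> snd P = Id M (fst P)"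
  using assms by (auto simp: coalgebra_def in_hom split: prod.splits)

lemma coalgebraI:
  assumes "X \<in> Obj M" "c \<in> hom M X (ob C X)"
    and "\<delta> X \<cdot>\<^bsub>M\<^esub> c = ar C c \<cdot>\<^bsub>M\<^esub> c" "\<epsilon> X \<cdot>\<^bsub>M\<^esub> c = Id M X"
  shows "coalgebra M C \<delta> \<epsilon> (X, c)"
  using assms by (simp add: coalgebra_def)

lemma coalgebras_simps [simp]:
  "P \<in> Obj (coalgebras M C \<delta> \<epsilon>) \<longleftrightarrow> coalgebra M C \<delta> \<epsilon> P"
  "Dom (coalgebras M C \<delta> \<epsilon>) u = fst u"
  "Cod (coalgebras M C \<delta> \<epsilon>) u = snd (snd u)"
  "Id (coalgebras M C \<delta> \<epsilon>) P = (P, Id M (fst P), P)"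
  "v \<cdot>\<^bsub>coalgebras M C \<delta> \<epsilon>\<^esub> u = (fst u, fst (snd v) \<cdot>\<^bsub>M\<^esub> fst (snd u), snd (snd v))"
  "(P, f, Q) \<in> Arr (coalgebras M C \<delta> \<epsilon>) \<longleftrightarrow>
     coalgebra M C \<delta> \<epsilon> P \<and> coalgebra M C \<delta> \<epsilon> Q \<and>
     f \<in> hom M (fst P) (fst Q) \<and> snd Q \<cdot>\<^bsub>M\<^esub> f = ar C f \<cdot>\<^bsub>M\<^esub> snd P"
  by (auto simp: coalgebras_def split: prod.splits)

lemma in_hom_coalgebras:
  "u \<in> hom (coalgebras M C \<delta> \<epsilon>) P Q \<longleftrightarrow>
     (\<exists>f. u = (P, f, Q) \<and> coalgebra M C \<delta> \<epsilon> P \<and> coalgebra M C \<delta> \<epsilon> Q \<and>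
       f \<in> hom M (fst P) (fst Q) \<and> snd Q \<cdot>\<^bsub>M\<^esub> f = ar C f \<cdot>\<^bsub>M\<^esub> snd P)"
  by (auto simp: coalgebras_def hom_def)

lemma triple_in_hom_coalgebras:
  "(P, f, Q) \<in> hom (coalgebras M C \<delta> \<epsilon>) P' Q' \<longleftrightarrow>
     P' = P \<and> Q' = Q \<and> coalgebra M C \<delta> \<epsilon> P \<and> coalgebra M C \<delta> \<epsilon> Q \<and>
     f \<in> hom M (fst P) (fst Q) \<and> snd Q \<cdot>\<^bsub>M\<^esub> f = ar C f \<cdot>\<^bsub>M\<^esub> snd P"
  by (auto simp: in_hom_coalgebras)

lemma coalgebras_cong:
  assumes "\<And>X. X \<in> Obj M \<Longrightarrow> \<delta> X = \<delta>' X" "\<And>X. X \<in> Obj M \<Longrightarrow> \<epsilon> X = \<epsilon>' X"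
  shows "coalgebras M C \<delta> \<epsilon> = coalgebras M C \<delta>' \<epsilon>'"
proof -
  have "coalgebra M C \<delta> \<epsilon> = coalgebra M C \<delta>' \<epsilon>'"
    using assms by (auto simp: coalgebra_def fun_eq_iff)
  then show ?thesis
    by (simp add: coalgebras_def)
qed

lemma category_coalgebras:
  assumes "is_functor M M C"
  shows "category (coalgebras M C \<delta> \<epsilon>)"
proof -
  interpret C: is_functor M M C by fact
  show ?thesis
  proof
    fix u P Q v R
    assume "u \<in> hom (coalgebras M C \<delta> \<epsilon>) P Q" "v \<in> hom (coalgebras M C \<delta> \<epsilon>) Q R"
    then obtain f g where u: "u = (P, f, Q)" "v = (Q, g, R)"
      and coalg: "coalgebra M C \<delta> \<epsilon> P" "coalgebra M C \<delta> \<epsilon> Q" "coalgebra M C \<delta> \<epsilon> R"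
      and f: "f \<in> hom M (fst P) (fst Q)" "snd Q \<cdot>\<^bsub>M\<^esub> f = ar C f \<cdot>\<^bsub>M\<^esub> snd P"
      and g: "g \<in> hom M (fst Q) (fst R)" "snd R \<cdot>\<^bsub>M\<^esub> g = ar C g \<cdot>\<^bsub>M\<^esub> snd Q"
      by (auto simp: in_hom_coalgebras)
    note d = coalgebraD[OF coalg(1)] coalgebraD[OF coalg(2)] coalgebraD[OF coalg(3)]
    have "snd R \<cdot>\<^bsub>M\<^esub> (g \<cdot>\<^bsub>M\<^esub> f) = ar C g \<cdot>\<^bsub>M\<^esub> (snd Q \<cdot>\<^bsub>M\<^esub> f)"
      using C.A.extend[OF g(2), of f] f(1) g(1) d(1-4,7-10,13-16) by (simp add: in_hom)
    also have "\<dots> = ar C (g \<cdot>\<^bsub>M\<^esub> f) \<cdot>\<^bsub>M\<^esub> snd P"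
      using f g(1) d(1-4,7-10,13-16) by (simp add: in_hom)
    finally show "v \<cdot>\<^bsub>coalgebras M C \<delta> \<epsilon>\<^esub> u \<in> hom (coalgebras M C \<delta> \<epsilon>) P R"
      using u coalg C.A.Comp_hom[OF f(1) g(1)] by (simp add: triple_in_hom_coalgebras)
  next
    fix P assume "P \<in> Obj (coalgebras M C \<delta> \<epsilon>)"
    then show "Id (coalgebras M C \<delta> \<epsilon>) P \<in> hom (coalgebras M C \<delta> \<epsilon>) P P"
      using coalgebraD(1-4)[of M C \<delta> \<epsilon> P] by (simp add: triple_in_hom_coalgebras in_hom)
  qed (auto simp: in_hom)
qed

text \<open>The inverse of an isomorphism that commutes with the coalgebra structures commutes with
  them as well; so the forgetful functor reflects isomorphisms.\<close>

lemma is_iso_coalgebras_iff: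
  assumes C: "is_functor M M C" and u: "(P, f, Q) \<in> hom (coalgebras M C \<delta> \<epsilon>) P Q"
  shows "is_iso (coalgebras M C \<delta> \<epsilon>) (P, f, Q) \<longleftrightarrow> is_iso M f"
proof
  interpret C: is_functor M M C by fact
  have coalg: "coalgebra M C \<delta> \<epsilon> P" "coalgebra M C \<delta> \<epsilon> Q"
    and f: "f \<in> hom M (fst P) (fst Q)" "snd Q \<cdot>\<^bsub>M\<^esub> f = ar C f \<cdot>\<^bsub>M\<^esub> snd P"
    using u by (auto simp: triple_in_hom_coalgebras)
  note d = coalgebraD[OF coalg(1)] coalgebraD[OF coalg(2)]
  {
    assume "is_iso (coalgebras M C \<delta> \<epsilon>) (P, f, Q)"
    then obtain v where v: "v \<in> hom (coalgebras M C \<delta> \<epsilon>) Q P"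
      "v \<cdot>\<^bsub>coalgebras M C \<delta> \<epsilon>\<^esub> (P, f, Q) = Id (coalgebras M C \<delta> \<epsilon>) P"
      "(P, f, Q) \<cdot>\<^bsub>coalgebras M C \<delta> \<epsilon>\<^esub> v = Id (coalgebras M C \<delta> \<epsilon>) Q"
      using is_isoE[OF _ u] by blast
    from v(1) obtain g where "v = (Q, g, P)" "g \<in> hom M (fst Q) (fst P)"
      by (auto simp: in_hom_coalgebras)
    then show "is_iso M f"
      using v(2,3) f(1) by (auto intro: is_isoI)
  next
    assume "is_iso M f"
    then obtain g where g: "g \<in> hom M (fst Q) (fst P)" "g \<cdot>\<^bsub>M\<^esub> f = Id M (fst P)"
      "f \<cdot>\<^bsub>M\<^esub> g = Id M (fst Q)"
      using is_isoE[OF _ f(1)] by blast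
    have "snd P \<cdot>\<^bsub>M\<^esub> g = ar C g \<cdot>\<^bsub>M\<^esub> (ar C f \<cdot>\<^bsub>M\<^esub> (snd P \<cdot>\<^bsub>M\<^esub> g))"
      using f(1) g(1) d(1-4,7-10) C.A.extend[OF C.ar_eq_Comp[OF g(2)], of "snd P \<cdot>\<^bsub>M\<^esub> g"]
      by (simp add: in_hom)
    also have "ar C f \<cdot>\<^bsub>M\<^esub> (snd P \<cdot>\<^bsub>M\<^esub> g) = snd Q \<cdot>\<^bsub>M\<^esub> (f \<cdot>\<^bsub>M\<^esub> g)"
      using f(1) g(1) d(1-4,7-10) C.A.extend[OF f(2), of g] by (simp add: in_hom)
    also have "\<dots> = snd Q"
      using g(3) d(7-10) by simp
    finally have "(Q, g, P) \<in> hom (coalgebras M C \<delta> \<epsilon>) Q P"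
      using coalg g(1) by (simp add: triple_in_hom_coalgebras)
    then show "is_iso (coalgebras M C \<delta> \<epsilon>) (P, f, Q)"
      by (rule is_isoI[OF u]) (simp_all add: g)
  }
qed

section \<open>Beck's comonadicity theorem for coreflexive pairs\<close>

definition beck_conditions where
  "beck_conditions M N H \<longleftrightarrow>
     (\<forall>f g. coreflexive_pair M f g \<longrightarrow> functor_split N H f g \<longrightarrow> (\<exists>e. is_equalizer M e f g)) \<and>
     (\<forall>f g. coreflexive_pair M f g \<longrightarrow> functor_split N H f g \<longrightarrow> preserves_equalizer M N H f g) \<and>
     conservative M N H"

text \<open>This is the Eilenberg--Moore comparison functor of an adjunction.  For the given
  adjunction it is \<^const>\<open>comparison\<close> for the identity comonad, with the trivial coalgebra
  structures on the objects of \<open>M\<close> left out.\<close>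

definition canonical_comparison where
  "canonical_comparison M H \<eta> =
     \<lparr>ob = \<lambda>X. (ob H X, ar H (\<eta> X)),
      ar = \<lambda>f. ((ob H (Dom M f), ar H (\<eta> (Dom M f))), ar H f,
                (ob H (Cod M f), ar H (\<eta> (Cod M f))))\<rparr>"

lemma canonical_comparison_simps [simp]:
  "ob (canonical_comparison M H \<eta>) X = (ob H X, ar H (\<eta> X))"
  "ar (canonical_comparison M H \<eta>) f =
     ((ob H (Dom M f), ar H (\<eta> (Dom M f))), ar H f, (ob H (Cod M f), ar H (\<eta> (Cod M f))))"
  by (simp_all add: canonical_comparison_def)

context adjunction
begin

text \<open>The comonad on \<open>N\<close> induced by the adjunction has functor \<open>T\<close>, comultiplication \<open>\<Delta>\<close> and
  counit \<open>\<xi>\<close>.\<close>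

abbreviation T where "T \<equiv> H \<circ>\<^sub>F K"
abbreviation \<Delta> where "\<Delta> \<equiv> \<lambda>Y. ar H (\<eta> (ob K Y))"
abbreviation Q where "Q \<equiv> canonical_comparison M H \<eta>"

lemma T_functor: "is_functor N N T"
  by (rule is_functor_comp[OF K.is_functor_axioms H.is_functor_axioms])

lemma unit_natural:
  "f \<in> Arr M \<Longrightarrow> Dom M f = X \<Longrightarrow> Cod M f = X' \<Longrightarrow>
     \<eta> X' \<cdot>\<^bsub>M\<^esub> f = ar K (ar H f) \<cdot>\<^bsub>M\<^esub> \<eta> X"
  using \<eta>.naturality_Arr[of f X X'] by simp

lemma unit_simps [simp]:
  assumes "X \<in> Obj M"
  shows "\<eta> X \<in> Arr M" "Dom M (\<eta> X) = X" "Cod M (\<eta> X) = ob K (ob H X)"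
  using \<eta>.component_simps[OF assms] by simp_all

lemma counit_simps [simp]:
  assumes "Y \<in> Obj N"
  shows "\<xi> Y \<in> Arr N" "Dom N (\<xi> Y) = ob H (ob K Y)" "Cod N (\<xi> Y) = Y"
  using \<xi>.component_simps[OF assms] by simp_all

lemma H_unit_natural:
  assumes "f \<in> Arr M" "Dom M f = X" "Cod M f = X'"
  shows "ar H (\<eta> X') \<cdot>\<^bsub>N\<^esub> ar H f = ar H (ar K (ar H f)) \<cdot>\<^bsub>N\<^esub> ar H (\<eta> X)"
proof -
  have "X \<in> Obj M" "X' \<in> Obj M"
    using assms by auto
  then show ?thesis
    using H.ar_eq_Comp[OF unit_natural[OF assms]] assms by simp
qed

lemma counit_natural:
  "g \<in> Arr N \<Longrightarrow> Dom N g = Y \<Longrightarrow> Cod N g = Y' \<Longrightarrow>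
     \<xi> Y' \<cdot>\<^bsub>N\<^esub> ar H (ar K g) = g \<cdot>\<^bsub>N\<^esub> \<xi> Y"
  using \<xi>.naturality_Arr[of g Y Y'] by simp

lemma canonical_coalgebra:
  assumes "X \<in> Obj M"
  shows "coalgebra N T \<Delta> \<xi> (ob H X, ar H (\<eta> X))"
  by (rule coalgebraI)
    (use assms H_unit_natural[of "\<eta> X" X "ob K (ob H X)"] triangle_H in \<open>simp_all add: in_hom\<close>)

lemma in_hom_canonical:
  assumes "X \<in> Obj M" "X' \<in> Obj M"
  shows "u \<in> hom (coalgebras N T \<Delta> \<xi>) (ob Q X) (ob Q X') \<longleftrightarrow>
    (\<exists>h. u = (ob Q X, h, ob Q X') \<and> h \<in> hom N (ob H X) (ob H X') \<and>
      ar H (\<eta> X') \<cdot>\<^bsub>N\<^esub> h = ar H (ar K h) \<cdot>\<^bsub>N\<^esub> ar H (\<eta> X))"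
  using canonical_coalgebra assms by (auto simp: in_hom_coalgebras)

lemma Q_functor: "is_functor M (coalgebras N T \<Delta> \<xi>) Q"
proof (intro is_functor.intro is_functor_axioms.intro)
  show "category (coalgebras N T \<Delta> \<xi>)"
    by (rule category_coalgebras[OF T_functor])
  show "ar Q f \<in> hom (coalgebras N T \<Delta> \<xi>) (ob Q X) (ob Q X')" if "f \<in> hom M X X'" for f X X'
    using that canonical_coalgebra H_unit_natural[of f X X']
    by (auto simp: in_hom)
qed (use canonical_coalgebra H.A.category_axioms in \<open>auto simp: in_hom\<close>)

text \<open>Every coalgebra is a split equalizer of a pair that comes from a coreflexive pair in
  \<open>M\<close>: the common retraction of that pair is \<open>K \<xi>\<^sub>Y\<close>, and the splitting in \<open>N\<close> is given by
  \<open>\<xi>\<^sub>Y\<close> and \<open>\<xi>\<^bsub>H K Y\<^esub>\<close>.  These are the pairs to which Beck's conditions are applied.\<close>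

lemma coalgebra_fork:
  assumes "coalgebra N T \<Delta> \<xi> (Y, y)"
  shows "coreflexive_pair M (\<eta> (ob K Y)) (ar K y)"
    and "split_cofork N y (ar H (\<eta> (ob K Y))) (ar H (ar K y))"
proof -
  have Y: "Y \<in> Obj N" and y: "y \<in> Arr N" "Dom N y = Y" "Cod N y = ob H (ob K Y)"
    and coassoc: "ar H (\<eta> (ob K Y)) \<cdot>\<^bsub>N\<^esub> y = ar H (ar K y) \<cdot>\<^bsub>N\<^esub> y"
    and counit: "\<xi> Y \<cdot>\<^bsub>N\<^esub> y = Id N Y"
    using coalgebraD[OF assms] by simp_all
  have "ar K (\<xi> Y) \<cdot>\<^bsub>M\<^esub> ar K y = Id M (ob K Y)"
    using K.ar_eq_Comp[OF counit] Y y by simp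
  then show "coreflexive_pair M (\<eta> (ob K Y)) (ar K y)"
    unfolding coreflexive_pair_def
    by (intro exI[of _ "ob K Y"] exI[of _ "ob K (ob H (ob K Y))"] conjI bexI[of _ "ar K (\<xi> Y)"])
      (use Y y triangle_K[OF Y] in \<open>simp_all add: in_hom\<close>)
  show "split_cofork N y (ar H (\<eta> (ob K Y))) (ar H (ar K y))"
    unfolding split_cofork_def
    by (intro exI[of _ Y] exI[of _ "ob H (ob K Y)"] exI[of _ "ob H (ob K (ob H (ob K Y)))"] conjI
        bexI[of _ "\<xi> Y"] bexI[of _ "\<xi> (ob H (ob K Y))"])
      (use Y y coassoc counit triangle_H[of "ob K Y"] counit_natural[OF y] in
        \<open>simp_all add: in_hom\<close>)
qed

lemma transpose:
  assumes "X \<in> Obj M" "h \<in> Arr N" "Dom N h = ob H X"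
  shows "\<xi> (Cod N h) \<cdot>\<^bsub>N\<^esub> (ar H (ar K h) \<cdot>\<^bsub>N\<^esub> ar H (\<eta> X)) = h"
  using assms H.B.extend[OF counit_natural[OF assms(2,3) refl], of "ar H (\<eta> X)"] triangle_H
  by simp

text \<open>\<open>H\<close> turns both \<open>\<eta>\<^sub>X\<close> and the equalizer that exists by assumption into equalizers of the
  same pair, the former because it is a split one.  So \<open>H\<close> sends the comparison between the
  two to an isomorphism; being conservative, it reflects this.\<close>

lemma unit_is_equalizer:
  assumes beck: "beck_conditions M N H" and X: "X \<in> Obj M"
  shows "is_equalizer M (\<eta> X) (\<eta> (ob K (ob H X))) (ar K (ar H (\<eta> X)))"
proof -
  let ?f = "\<eta> (ob K (ob H X))" and ?g = "ar K (ar H (\<eta> X))"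
  note fork = coalgebra_fork[OF canonical_coalgebra[OF X]]
  have split: "functor_split N H ?f ?g"
    using fork(2) unfolding functor_split_def by blast
  obtain e where e: "is_equalizer M e ?f ?g"
    using beck fork(1) split unfolding beck_conditions_def by blast
  have He: "is_equalizer N (ar H e) (ar H ?f) (ar H ?g)"
    using beck fork(1) split e unfolding beck_conditions_def preserves_equalizer_def by blast
  have e_hom: "e \<in> hom M (Dom M e) (ob K (ob H X))"
    using is_equalizerD(1,2)[OF e] X by (simp add: in_hom)
  have \<eta>_hom: "\<eta> X \<in> hom M X (ob K (ob H X))"
    using X by (simp add: in_hom)
  have "?f \<cdot>\<^bsub>M\<^esub> \<eta> X = ?g \<cdot>\<^bsub>M\<^esub> \<eta> X"
    using unit_natural[of "\<eta> X" X] X by simp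
  then obtain k where k: "k \<in> hom M X (Dom M e)" "e \<cdot>\<^bsub>M\<^esub> k = \<eta> X"
    using is_equalizer_factor[OF e e_hom \<eta>_hom] by blast
  have "ar H e \<cdot>\<^bsub>N\<^esub> ar H k = ar H (\<eta> X)"
    using H.ar_eq_Comp[OF k(2)] k(1) e_hom by (simp add: in_hom)
  then have "is_iso N (ar H k)"
    using H.B.equalizers_factor_iso[OF He H.B.split_cofork_is_equalizer[OF fork(2)]
        H.ar_hom[OF e_hom] H.ar_hom[OF \<eta>_hom] H.ar_hom[OF k(1)]] by blast
  then have "is_iso M k"
    using beck k(1) unfolding beck_conditions_def conservative_def by (simp add: in_hom)
  then show ?thesis
    using H.A.is_equalizer_Comp_iso[OF e _ e_hom k(1)] k(2) by simp
qed

text \<open>A coalgebra morphism \<open>h : H X \<rightarrow> H X'\<close> transposes to \<open>(K h) \<eta>\<^sub>X : X \<rightarrow> K H X'\<close>, and compatibility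
  of \<open>h\<close> with the coalgebra structures says exactly that this transpose equalizes the pair
  whose equalizer is \<open>\<eta>\<^bsub>X'\<^esub>\<close>.  It thus factors uniquely through \<open>\<eta>\<^bsub>X'\<^esub>\<close>, and the factor is the
  preimage of \<open>h\<close>.  A coalgebra \<open>(Y, y)\<close> is isomorphic to the image of the equalizer \<open>E\<close> of
  \<open>\<eta>\<^bsub>K Y\<^esub>\<close> and \<open>K y\<close>, because \<open>H\<close> preserves this equalizer and \<open>y\<close> is another equalizer of the
  image pair.\<close>

lemma beck_sufficient:
  assumes beck: "beck_conditions M N H"
  shows "is_equivalence M (coalgebras N T \<Delta> \<xi>) Q"
proof (rule is_functor.is_equivalenceI[OF Q_functor])
  interpret Q: is_functor M "coalgebras N T \<Delta> \<xi>" Q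
    by (rule Q_functor)
  show "fully_faithful M (coalgebras N T \<Delta> \<xi>) Q"
  proof (rule Q.fully_faithfulI)
    fix X X' k k'
    assume X: "X \<in> Obj M" "X' \<in> Obj M" and k: "k \<in> hom M X X'" "k' \<in> hom M X X'"
      and eq: "ar Q k = ar Q k'"
    have "\<eta> X' \<cdot>\<^bsub>M\<^esub> k = \<eta> X' \<cdot>\<^bsub>M\<^esub> k'"
      using unit_natural[of k X X'] unit_natural[of k' X X'] k eq by (simp add: in_hom)
    then show "k = k'"
      using H.A.is_equalizer_mono[OF unit_is_equalizer[OF beck X(2)] _ k] X
      by (simp add: in_hom)
  next
    fix X X' u
    assume X: "X \<in> Obj M" "X' \<in> Obj M"
      and "u \<in> hom (coalgebras N T \<Delta> \<xi>) (ob Q X) (ob Q X')"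
    then obtain h where u: "u = (ob Q X, h, ob Q X')"
      and h_hom: "h \<in> hom N (ob H X) (ob H X')"
      and coalg: "ar H (\<eta> X') \<cdot>\<^bsub>N\<^esub> h = ar H (ar K h) \<cdot>\<^bsub>N\<^esub> ar H (\<eta> X)"
      using in_hom_canonical[OF X] by blast
    note h = h_hom[unfolded in_hom, THEN conjunct1]
      h_hom[unfolded in_hom, THEN conjunct2, THEN conjunct1]
      h_hom[unfolded in_hom, THEN conjunct2, THEN conjunct2]
    define t where "t = ar K h \<cdot>\<^bsub>M\<^esub> \<eta> X"
    have t: "t \<in> Arr M" "Dom M t = X" "Cod M t = ob K (ob H X')"
      using X h by (simp_all add: t_def)
    have "\<eta> (ob K (ob H X')) \<cdot>\<^bsub>M\<^esub> t = ar K (ar H t) \<cdot>\<^bsub>M\<^esub> \<eta> X"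
      by (rule unit_natural[OF t])
    also have "ar H t = ar H (\<eta> X') \<cdot>\<^bsub>N\<^esub> h"
      using X h coalg by (simp add: t_def)
    also have "ar K (ar H (\<eta> X') \<cdot>\<^bsub>N\<^esub> h) \<cdot>\<^bsub>M\<^esub> \<eta> X = ar K (ar H (\<eta> X')) \<cdot>\<^bsub>M\<^esub> t"
      using X h by (simp add: t_def)
    finally obtain k where k: "k \<in> hom M X X'" "\<eta> X' \<cdot>\<^bsub>M\<^esub> k = t"
      using is_equalizer_factor[OF unit_is_equalizer[OF beck X(2)], of X' _ t X] X t
      by (auto simp: in_hom)
    have "ar H t = ar H (ar K (ar H k)) \<cdot>\<^bsub>N\<^esub> ar H (\<eta> X)"
      using H.ar_eq_Comp[OF k(2)] H_unit_natural[of k X X'] k(1) X by (simp add: in_hom)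
    then have "ar H (ar K h) \<cdot>\<^bsub>N\<^esub> ar H (\<eta> X) = ar H (ar K (ar H k)) \<cdot>\<^bsub>N\<^esub> ar H (\<eta> X)"
      using X h by (simp add: t_def)
    then have "h = ar H k"
      using transpose[OF X(1) h(1,2)] transpose[OF X(1), of "ar H k"] k(1) h(3)
      by (simp add: in_hom)
    then show "\<exists>k \<in> hom M X X'. ar Q k = u"
      using k(1) u by (intro bexI[of _ k]) (auto simp: in_hom)
  qed
  show "essentially_surjective M (coalgebras N T \<Delta> \<xi>) Q"
    unfolding essentially_surjective_def
  proof
    fix P assume "P \<in> Obj (coalgebras N T \<Delta> \<xi>)"
    then obtain Y y where P: "P = (Y, y)" and coalg: "coalgebra N T \<Delta> \<xi> (Y, y)"
      by (cases P) simp
    note fork = coalgebra_fork[OF coalg]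
    have Y: "Y \<in> Obj N" and y: "y \<in> Arr N" "Dom N y = Y" "Cod N y = ob H (ob K Y)"
      and counit: "\<xi> Y \<cdot>\<^bsub>N\<^esub> y = Id N Y"
      using coalgebraD[OF coalg] by simp_all
    have split: "functor_split N H (\<eta> (ob K Y)) (ar K y)"
      using fork(2) unfolding functor_split_def by blast
    obtain e where e: "is_equalizer M e (\<eta> (ob K Y)) (ar K y)"
      using beck fork(1) split unfolding beck_conditions_def by blast
    have He: "is_equalizer N (ar H e) (ar H (\<eta> (ob K Y))) (ar H (ar K y))"
      using beck fork(1) split e unfolding beck_conditions_def preserves_equalizer_def by blast
    define E where "E = Dom M e"
    have e_hom: "e \<in> hom M E (ob K Y)"
      using is_equalizerD(1,2)[OF e] Y by (simp add: in_hom E_def)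
    then have E: "E \<in> Obj M"
      by (auto simp: in_hom)
    obtain i where i: "i \<in> hom N (ob H E) Y" "y \<cdot>\<^bsub>N\<^esub> i = ar H e" "is_iso N i"
      using H.B.equalizers_iso[OF H.B.split_cofork_is_equalizer[OF fork(2)] He, of Y _ "ob H E"]
        y H.ar_hom[OF e_hom] by (auto simp: in_hom)
    \<comment> \<open>The isomorphism is the transpose of \<open>e\<close>, which makes it a coalgebra morphism.\<close>
    have "\<xi> Y \<cdot>\<^bsub>N\<^esub> ar H e = i"
      using H.B.extend[OF counit, of i] i(1,2) Y y by (simp add: in_hom)
    then have "ar K i = ar K (\<xi> Y) \<cdot>\<^bsub>M\<^esub> ar K (ar H e)"
      using e_hom Y K.ar_eq_Comp[of "\<xi> Y" "ar H e" i] by (simp add: in_hom)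
    then have "ar K i \<cdot>\<^bsub>M\<^esub> \<eta> E = ar K (\<xi> Y) \<cdot>\<^bsub>M\<^esub> (\<eta> (ob K Y) \<cdot>\<^bsub>M\<^esub> e)"
      using unit_natural[of e E "ob K Y"] e_hom E Y by (simp add: in_hom)
    also have "\<dots> = e"
      using H.A.extend[OF triangle_K[OF Y], of e] e_hom Y by (simp add: in_hom)
    finally have "ar H (ar K i) \<cdot>\<^bsub>N\<^esub> ar H (\<eta> E) = ar H e"
      using H.ar_eq_Comp[of "ar K i" "\<eta> E" e] i(1) E by (simp add: in_hom)
    then have "(ob Q E, i, P) \<in> hom (coalgebras N T \<Delta> \<xi>) (ob Q E) P"
      using i coalg canonical_coalgebra[OF E] P by (simp add: triple_in_hom_coalgebras)
    moreover have "is_iso (coalgebras N T \<Delta> \<xi>) (ob Q E, i, P)"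
      using is_iso_coalgebras_iff[OF T_functor calculation] i(3) by blast
    ultimately show "\<exists>X \<in> Obj M. \<exists>u \<in> hom (coalgebras N T \<Delta> \<xi>) (ob Q X) P.
        is_iso (coalgebras N T \<Delta> \<xi>) u"
      using E by blast
  qed
qed

text \<open>A split equalizer \<open>e : E \<rightarrow> H X\<close> of \<open>H f\<close> and \<open>H g\<close> is preserved by every functor.  Hence the
  coalgebra structure of \<open>H X\<close> restricts to \<open>E\<close>, and by essential surjectivity \<open>E\<close> is
  isomorphic to some \<open>H Z\<close> as a coalgebra.  By fullness the composite \<open>H Z \<cong> E \<rightarrow> H X\<close> is the
  image of an arrow \<open>e' : Z \<rightarrow> X\<close>, which is the required equalizer, and \<open>H\<close> preserves it by
  construction.  Since equalizers are unique up to isomorphism, \<open>H\<close> then preserves every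
  equalizer of \<open>f\<close> and \<open>g\<close>.\<close>

lemma beck_necessary:
  assumes equiv: "is_equivalence M (coalgebras N T \<Delta> \<xi>) Q"
  shows "beck_conditions M N H"
proof -
  interpret Q: is_functor M "coalgebras N T \<Delta> \<xi>" Q
    by (rule Q_functor)
  note T_eq_Comp = is_functor.ar_eq_Comp[OF T_functor]
  note ff = is_equivalence_fully_faithful[OF equiv]
  have faithful: "k = k'" if "k \<in> hom M X X'" "k' \<in> hom M X X'" "ar H k = ar H k'" for k k' X X'
    using that by (intro fully_faithful_inj[OF ff, of X X']) (auto simp: in_hom)
  have full: "\<exists>k \<in> hom M X X'. ar H k = h"
    if "X \<in> Obj M" "X' \<in> Obj M" "h \<in> hom N (ob H X) (ob H X')"
      "ar H (\<eta> X') \<cdot>\<^bsub>N\<^esub> h = ar H (ar K h) \<cdot>\<^bsub>N\<^esub> ar H (\<eta> X)" for X X' h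
    using fully_faithful_surj[OF ff that(1,2), of "(ob Q X, h, ob Q X')"] that
    by (auto simp: in_hom_canonical simp del: canonical_comparison_simps(1))
  have conservative: "conservative M N H"
    unfolding conservative_def
  proof (intro ballI impI)
    fix f assume f: "f \<in> Arr M" "is_iso N (ar H f)"
    then have "ar Q f \<in> hom (coalgebras N T \<Delta> \<xi>) (ob Q (Dom M f)) (ob Q (Cod M f))"
      by (intro Q.ar_hom) (simp add: in_hom)
    then have "is_iso (coalgebras N T \<Delta> \<xi>) (ar Q f)"
      using is_iso_coalgebras_iff[OF T_functor] f(2) by simp
    then show "is_iso M f"
      by (rule Q.fully_faithful_reflects_iso[OF ff f(1)])
  qed
  have lift: "\<exists>e. is_equalizer M e f g \<and> is_equalizer N (ar H e) (ar H f) (ar H g)"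
    if fg: "f \<in> hom M X Y" "g \<in> hom M X Y" and split: "functor_split N H f g" for f g X Y
  proof -
    have XY: "X \<in> Obj M" "Y \<in> Obj M"
      using fg by (auto simp: in_hom)
    obtain e where cofork: "split_cofork N e (ar H f) (ar H g)"
      using split unfolding functor_split_def by blast
    obtain E p q where e: "e \<in> hom N E (ob H X)" "ar H f \<cdot>\<^bsub>N\<^esub> e = ar H g \<cdot>\<^bsub>N\<^esub> e"
      "p \<in> hom N (ob H X) E" "q \<in> hom N (ob H Y) (ob H X)"
      "p \<cdot>\<^bsub>N\<^esub> e = Id N E" "q \<cdot>\<^bsub>N\<^esub> ar H f = Id N (ob H X)" "e \<cdot>\<^bsub>N\<^esub> p = q \<cdot>\<^bsub>N\<^esub> ar H g"
      using cofork fg by (auto simp: split_cofork_def in_hom)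
    have E: "E \<in> Obj N"
      using e(1) by (auto simp: in_hom)
    note typing = XY E fg[unfolded in_hom] e(1,3,4)[unfolded in_hom]
    \<comment> \<open>\<open>T p\<close> is a retraction of \<open>T e\<close>, so this is the only candidate for a restriction of the
      structure \<open>H \<eta>\<^sub>X\<close> along \<open>e\<close>.\<close>
    define y where "y = ar T p \<cdot>\<^bsub>N\<^esub> (ar H (\<eta> X) \<cdot>\<^bsub>N\<^esub> e)"
    have y: "y \<in> Arr N" "Dom N y = E" "Cod N y = ob T E"
      using typing by (simp_all add: y_def)
    have Te_y: "ar T e \<cdot>\<^bsub>N\<^esub> y = ar H (\<eta> X) \<cdot>\<^bsub>N\<^esub> e"
    proof -
      have "ar T e \<cdot>\<^bsub>N\<^esub> y = ar T (e \<cdot>\<^bsub>N\<^esub> p) \<cdot>\<^bsub>N\<^esub> (ar H (\<eta> X) \<cdot>\<^bsub>N\<^esub> e)"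
        using typing by (simp add: y_def)
      also have "\<dots> = ar T q \<cdot>\<^bsub>N\<^esub> (ar T (ar H g) \<cdot>\<^bsub>N\<^esub> (ar H (\<eta> X) \<cdot>\<^bsub>N\<^esub> e))"
        using typing by (simp add: e(7))
      also have "ar T (ar H g) \<cdot>\<^bsub>N\<^esub> (ar H (\<eta> X) \<cdot>\<^bsub>N\<^esub> e) = ar H (\<eta> Y) \<cdot>\<^bsub>N\<^esub> (ar H g \<cdot>\<^bsub>N\<^esub> e)"
        using typing H.B.extend[OF H_unit_natural[of g X Y], of e] by simp
      also have "\<dots> = ar H (\<eta> Y) \<cdot>\<^bsub>N\<^esub> (ar H f \<cdot>\<^bsub>N\<^esub> e)"
        by (simp add: e(2))
      also have "\<dots> = ar T (ar H f) \<cdot>\<^bsub>N\<^esub> (ar H (\<eta> X) \<cdot>\<^bsub>N\<^esub> e)"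
        using typing H.B.extend[OF H_unit_natural[of f X Y], of e] by simp
      also have "ar T q \<cdot>\<^bsub>N\<^esub> \<dots> = ar T (q \<cdot>\<^bsub>N\<^esub> ar H f) \<cdot>\<^bsub>N\<^esub> (ar H (\<eta> X) \<cdot>\<^bsub>N\<^esub> e)"
        using typing by simp
      also have "\<dots> = ar H (\<eta> X) \<cdot>\<^bsub>N\<^esub> e"
        unfolding e(6) using typing by simp
      finally show ?thesis .
    qed
    have coalg: "coalgebra N T \<Delta> \<xi> (E, y)"
    proof (rule coalgebraI[OF E])
      show "y \<in> hom N E (ob T E)"
        using y by (simp add: in_hom)
      have "\<xi> E \<cdot>\<^bsub>N\<^esub> y = p \<cdot>\<^bsub>N\<^esub> (\<xi> (ob H X) \<cdot>\<^bsub>N\<^esub> (ar H (\<eta> X) \<cdot>\<^bsub>N\<^esub> e))"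
        using typing H.B.extend[OF counit_natural[of p "ob H X" E], of "ar H (\<eta> X) \<cdot>\<^bsub>N\<^esub> e"]
        by (simp add: y_def)
      also have "\<dots> = Id N E"
        using typing H.B.extend[OF triangle_H[OF XY(1)], of e] e(5) by simp
      finally show "\<xi> E \<cdot>\<^bsub>N\<^esub> y = Id N E" .
      have "ar T (ar T e) \<cdot>\<^bsub>N\<^esub> (\<Delta> E \<cdot>\<^bsub>N\<^esub> y) = \<Delta> (ob H X) \<cdot>\<^bsub>N\<^esub> (ar T e \<cdot>\<^bsub>N\<^esub> y)"
        using typing y H.B.extend[OF H_unit_natural[of "ar K e" "ob K E" "ob K (ob H X)"], of y]
        by simp
      also have "\<dots> = ar T (ar H (\<eta> X)) \<cdot>\<^bsub>N\<^esub> (ar H (\<eta> X) \<cdot>\<^bsub>N\<^esub> e)"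
        unfolding Te_y
        using typing H.B.extend[OF coalgebraD(5)[OF canonical_coalgebra[OF XY(1)]], of e] by simp
      also have "\<dots> = ar T (ar H (\<eta> X)) \<cdot>\<^bsub>N\<^esub> (ar T e \<cdot>\<^bsub>N\<^esub> y)"
        by (simp only: Te_y)
      also have "\<dots> = ar T (ar H (\<eta> X) \<cdot>\<^bsub>N\<^esub> e) \<cdot>\<^bsub>N\<^esub> y"
        using typing y by simp
      also have "\<dots> = ar T (ar T e \<cdot>\<^bsub>N\<^esub> y) \<cdot>\<^bsub>N\<^esub> y"
        by (simp only: Te_y)
      finally have *: "ar T (ar T e) \<cdot>\<^bsub>N\<^esub> (\<Delta> E \<cdot>\<^bsub>N\<^esub> y) = ar T (ar T e) \<cdot>\<^bsub>N\<^esub> (ar T y \<cdot>\<^bsub>N\<^esub> y)"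
        using typing y by simp
      have "ar T (ar T p) \<cdot>\<^bsub>N\<^esub> ar T (ar T e) = Id N (ob T (ob T E))"
        using typing T_eq_Comp[OF T_eq_Comp[OF e(5)]] by simp
      then have cancel: "ar T (ar T p) \<cdot>\<^bsub>N\<^esub> (ar T (ar T e) \<cdot>\<^bsub>N\<^esub> x) = x"
        if "x \<in> Arr N" "Cod N x = ob T (ob T E)" for x
        using that typing H.B.extend[of "ar T (ar T p)" "ar T (ar T e)" _ x] by simp
      have "\<Delta> E \<cdot>\<^bsub>N\<^esub> y = ar T (ar T p) \<cdot>\<^bsub>N\<^esub> (ar T (ar T e) \<cdot>\<^bsub>N\<^esub> (\<Delta> E \<cdot>\<^bsub>N\<^esub> y))"
        by (rule cancel[symmetric]) (use typing y in simp_all)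
      also have "\<dots> = ar T (ar T p) \<cdot>\<^bsub>N\<^esub> (ar T (ar T e) \<cdot>\<^bsub>N\<^esub> (ar T y \<cdot>\<^bsub>N\<^esub> y))"
        by (simp only: *)
      also have "\<dots> = ar T y \<cdot>\<^bsub>N\<^esub> y"
        by (rule cancel) (use typing y in simp_all)
      finally show "\<Delta> E \<cdot>\<^bsub>N\<^esub> y = ar T y \<cdot>\<^bsub>N\<^esub> y" .
    qed
    then obtain Z u where Z: "Z \<in> Obj M" "u \<in> hom (coalgebras N T \<Delta> \<xi>) (ob Q Z) (E, y)"
      "is_iso (coalgebras N T \<Delta> \<xi>) u"
      using is_equivalence_essentially_surjective[OF equiv]
      unfolding essentially_surjective_def by (metis coalgebras_simps(1))
    then obtain i where u: "u = (ob Q Z, i, (E, y))" and i: "i \<in> hom N (ob H Z) E"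
      and yi: "y \<cdot>\<^bsub>N\<^esub> i = ar T i \<cdot>\<^bsub>N\<^esub> ar H (\<eta> Z)"
      by (auto simp: in_hom_coalgebras)
    have iso: "is_iso N i"
      using is_iso_coalgebras_iff[OF T_functor, of "ob Q Z" i "(E, y)"] Z(2,3) u by blast
    obtain j where j: "j \<in> hom N E (ob H Z)" "j \<cdot>\<^bsub>N\<^esub> i = Id N (ob H Z)"
      using is_isoE[OF iso i] .
    note typing = typing Z(1) y i[unfolded in_hom] j(1)[unfolded in_hom]
    have "ar H (\<eta> X) \<cdot>\<^bsub>N\<^esub> (e \<cdot>\<^bsub>N\<^esub> i) = ar T e \<cdot>\<^bsub>N\<^esub> (y \<cdot>\<^bsub>N\<^esub> i)"
      using typing H.B.extend[OF Te_y, of i] by simp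
    also have "\<dots> = ar T (e \<cdot>\<^bsub>N\<^esub> i) \<cdot>\<^bsub>N\<^esub> ar H (\<eta> Z)"
      unfolding yi using typing by simp
    finally obtain e' where e': "e' \<in> hom M Z X" "ar H e' = e \<cdot>\<^bsub>N\<^esub> i"
      using full[OF Z(1) XY(1), of "e \<cdot>\<^bsub>N\<^esub> i"] typing by (auto simp: in_hom)
    note typing = typing e'(1)[unfolded in_hom]
    have He': "is_equalizer N (ar H e') (ar H f) (ar H g)"
      unfolding e'(2)
      using H.B.is_equalizer_Comp_iso[OF H.B.split_cofork_is_equalizer[OF cofork] iso e(1) i] .
    \<comment> \<open>As \<open>H e'\<close> is a split monomorphism, so is \<open>T (H e')\<close>; factorisations through \<open>H e'\<close> are
      therefore coalgebra morphisms, to which fullness applies.\<close>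
    have retract: "(j \<cdot>\<^bsub>N\<^esub> p) \<cdot>\<^bsub>N\<^esub> ar H e' = Id N (ob H Z)"
      unfolding e'(2) using typing H.B.extend[OF e(5), of i] j(2) by simp
    have "is_equalizer M e' f g"
    proof (rule is_equalizerI[OF e'(1) fg])
      have "ar H f \<cdot>\<^bsub>N\<^esub> ar H e' = ar H g \<cdot>\<^bsub>N\<^esub> ar H e'"
        by (rule is_equalizerD(4)[OF He'])
      then show "f \<cdot>\<^bsub>M\<^esub> e' = g \<cdot>\<^bsub>M\<^esub> e'"
        using typing by (intro faithful[of _ Z Y]) (simp_all add: in_hom)
    next
      fix W h
      assume h: "h \<in> hom M W X" "f \<cdot>\<^bsub>M\<^esub> h = g \<cdot>\<^bsub>M\<^esub> h"
      have W: "W \<in> Obj M"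
        using h(1) by (auto simp: in_hom)
      have "ar H f \<cdot>\<^bsub>N\<^esub> ar H h = ar H g \<cdot>\<^bsub>N\<^esub> ar H h"
        using H.ar_eq_Comp[OF h(2)] h(1) typing by (simp add: in_hom)
      then obtain l where l: "l \<in> hom N (ob H W) (ob H Z)" "ar H e' \<cdot>\<^bsub>N\<^esub> l = ar H h"
        using is_equalizer_factor[OF He' H.ar_hom[OF e'(1)] H.ar_hom[OF h(1)]] by blast
      note typing = typing W h(1)[unfolded in_hom] l(1)[unfolded in_hom]
      have "ar T (ar H e') \<cdot>\<^bsub>N\<^esub> (ar H (\<eta> Z) \<cdot>\<^bsub>N\<^esub> l) = ar H (\<eta> X) \<cdot>\<^bsub>N\<^esub> (ar H e' \<cdot>\<^bsub>N\<^esub> l)"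
        using typing H.B.extend[OF H_unit_natural[of e' Z X], of l] by simp
      also have "\<dots> = ar T (ar H e' \<cdot>\<^bsub>N\<^esub> l) \<cdot>\<^bsub>N\<^esub> ar H (\<eta> W)"
        unfolding l(2) using typing H_unit_natural[of h W X] by simp
      finally have *: "ar T (ar H e') \<cdot>\<^bsub>N\<^esub> (ar H (\<eta> Z) \<cdot>\<^bsub>N\<^esub> l) =
          ar T (ar H e') \<cdot>\<^bsub>N\<^esub> (ar T l \<cdot>\<^bsub>N\<^esub> ar H (\<eta> W))"
        using typing by simp
      have "ar T (j \<cdot>\<^bsub>N\<^esub> p) \<cdot>\<^bsub>N\<^esub> ar T (ar H e') = Id N (ob T (ob H Z))"
        using typing T_eq_Comp[OF retract] by simp
      then have cancel: "ar T (j \<cdot>\<^bsub>N\<^esub> p) \<cdot>\<^bsub>N\<^esub> (ar T (ar H e') \<cdot>\<^bsub>N\<^esub> x) = x"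
        if "x \<in> Arr N" "Cod N x = ob T (ob H Z)" for x
        using that typing H.B.extend[of "ar T (j \<cdot>\<^bsub>N\<^esub> p)" "ar T (ar H e')" _ x] by simp
      have "ar H (\<eta> Z) \<cdot>\<^bsub>N\<^esub> l = ar T (j \<cdot>\<^bsub>N\<^esub> p) \<cdot>\<^bsub>N\<^esub> (ar T (ar H e') \<cdot>\<^bsub>N\<^esub> (ar H (\<eta> Z) \<cdot>\<^bsub>N\<^esub> l))"
        by (rule cancel[symmetric]) (use typing in simp_all)
      also have "\<dots> = ar T (j \<cdot>\<^bsub>N\<^esub> p) \<cdot>\<^bsub>N\<^esub> (ar T (ar H e') \<cdot>\<^bsub>N\<^esub> (ar T l \<cdot>\<^bsub>N\<^esub> ar H (\<eta> W)))"
        by (simp only: *)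
      also have "\<dots> = ar T l \<cdot>\<^bsub>N\<^esub> ar H (\<eta> W)"
        by (rule cancel) (use typing in simp_all)
      finally have "ar H (\<eta> Z) \<cdot>\<^bsub>N\<^esub> l = ar T l \<cdot>\<^bsub>N\<^esub> ar H (\<eta> W)" .
      then obtain k where k: "k \<in> hom M W Z" "ar H k = l"
        using full[OF W Z(1) l(1)] by auto
      have "e' \<cdot>\<^bsub>M\<^esub> k = h"
        using k l(2) typing by (intro faithful[of _ W X]) (simp_all add: in_hom)
      then show "\<exists>k \<in> hom M W Z. e' \<cdot>\<^bsub>M\<^esub> k = h"
        using k(1) by blast
    next
      fix W k k'
      assume k: "k \<in> hom M W Z" "k' \<in> hom M W Z" "e' \<cdot>\<^bsub>M\<^esub> k = e' \<cdot>\<^bsub>M\<^esub> k'"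
      have "ar H e' \<cdot>\<^bsub>N\<^esub> ar H k = ar H e' \<cdot>\<^bsub>N\<^esub> ar H k'"
        using H.ar_eq_Comp[OF k(3)] k typing by (simp add: in_hom)
      then have "ar H k = ar H k'"
        by (rule H.B.is_equalizer_mono[OF He' H.ar_hom[OF e'(1)] H.ar_hom[OF k(1)] H.ar_hom[OF k(2)]])
      then show "k = k'"
        using faithful k by blast
    qed
    with He' show ?thesis
      by blast
  qed
  have preserves: "preserves_equalizer M N H f g"
    if fg: "f \<in> hom M X Y" "g \<in> hom M X Y" "functor_split N H f g" for f g X Y
    unfolding preserves_equalizer_def
  proof (intro allI impI)
    fix d assume d: "is_equalizer M d f g"
    obtain e where e: "is_equalizer M e f g" "is_equalizer N (ar H e) (ar H f) (ar H g)"
      using lift[OF fg] by blast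
    have hom: "e \<in> hom M (Dom M e) X" "d \<in> hom M (Dom M d) X"
      using is_equalizerD(1,2)[OF e(1)] is_equalizerD(1,2)[OF d] fg(1) by (auto simp: in_hom)
    obtain k where k: "k \<in> hom M (Dom M d) (Dom M e)" "e \<cdot>\<^bsub>M\<^esub> k = d" "is_iso M k"
      using H.A.equalizers_iso[OF e(1) d hom] .
    have "ar H e \<cdot>\<^bsub>N\<^esub> ar H k = ar H d"
      using H.ar_eq_Comp[OF k(2)] k(1) hom by (simp add: in_hom)
    then show "is_equalizer N (ar H d) (ar H f) (ar H g)"
      using H.B.is_equalizer_Comp_iso[OF e(2) H.preserves_iso[OF k(3)] H.ar_hom[OF hom(1)]
          H.ar_hom[OF k(1)]] by simp
  qed
  show ?thesis
    unfolding beck_conditions_def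
    using lift preserves conservative by (auto simp: coreflexive_pair_def) blast+
qed

end

section \<open>Composition of adjunctions\<close>

lemma adjunction_comp:
  assumes "adjunction A B F G \<eta> \<xi>" "adjunction B C F' G' \<eta>' \<xi>'"
  shows "adjunction A C (F' \<circ>\<^sub>F F) (G \<circ>\<^sub>F G')
    (\<lambda>X. ar G (\<eta>' (ob F X)) \<cdot>\<^bsub>A\<^esub> \<eta> X) (\<lambda>Z. \<xi>' Z \<cdot>\<^bsub>C\<^esub> ar F' (\<xi> (ob G' Z)))"
proof -
  interpret L: adjunction A B F G \<eta> \<xi> by fact
  interpret R: adjunction B C F' G' \<eta>' \<xi>' by fact
  show ?thesis
  proof unfold_locales
    fix f X Y assume f: "f \<in> hom A X Y"
    then have X: "X \<in> Obj A" "Y \<in> Obj A"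
      by (auto simp: in_hom)
    have "(ar G (\<eta>' (ob F Y)) \<cdot>\<^bsub>A\<^esub> \<eta> Y) \<cdot>\<^bsub>A\<^esub> f =
        ar G (\<eta>' (ob F Y)) \<cdot>\<^bsub>A\<^esub> (ar G (ar F f) \<cdot>\<^bsub>A\<^esub> \<eta> X)"
      using f X L.unit_natural[of f X Y] by (simp add: in_hom)
    also have "\<dots> = ar G (\<eta>' (ob F Y) \<cdot>\<^bsub>B\<^esub> ar F f) \<cdot>\<^bsub>A\<^esub> \<eta> X"
      using f X by (simp add: in_hom)
    also have "\<eta>' (ob F Y) \<cdot>\<^bsub>B\<^esub> ar F f = ar G' (ar F' (ar F f)) \<cdot>\<^bsub>B\<^esub> \<eta>' (ob F X)"
      using f R.unit_natural[of "ar F f" "ob F X" "ob F Y"] by (simp add: in_hom)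
    finally show "(ar G (\<eta>' (ob F Y)) \<cdot>\<^bsub>A\<^esub> \<eta> Y) \<cdot>\<^bsub>A\<^esub> ar id_functor f =
        ar ((G \<circ>\<^sub>F G') \<circ>\<^sub>F F' \<circ>\<^sub>F F) f \<cdot>\<^bsub>A\<^esub> (ar G (\<eta>' (ob F X)) \<cdot>\<^bsub>A\<^esub> \<eta> X)"
      using f X by (simp add: in_hom)
  next
    fix g Y Z assume g: "g \<in> hom C Y Z"
    then have Y: "Y \<in> Obj C" "Z \<in> Obj C"
      by (auto simp: in_hom)
    have "(\<xi>' Z \<cdot>\<^bsub>C\<^esub> ar F' (\<xi> (ob G' Z))) \<cdot>\<^bsub>C\<^esub> ar F' (ar F (ar G (ar G' g))) =
        \<xi>' Z \<cdot>\<^bsub>C\<^esub> ar F' (\<xi> (ob G' Z) \<cdot>\<^bsub>B\<^esub> ar F (ar G (ar G' g)))"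
      using g Y by (simp add: in_hom)
    also have "\<xi> (ob G' Z) \<cdot>\<^bsub>B\<^esub> ar F (ar G (ar G' g)) = ar G' g \<cdot>\<^bsub>B\<^esub> \<xi> (ob G' Y)"
      using g L.counit_natural[of "ar G' g" "ob G' Y" "ob G' Z"] by (simp add: in_hom)
    also have "\<xi>' Z \<cdot>\<^bsub>C\<^esub> ar F' (ar G' g \<cdot>\<^bsub>B\<^esub> \<xi> (ob G' Y)) =
        g \<cdot>\<^bsub>C\<^esub> (\<xi>' Y \<cdot>\<^bsub>C\<^esub> ar F' (\<xi> (ob G' Y)))"
      using g Y R.H.B.extend[OF R.counit_natural[of g Y Z], of "ar F' (\<xi> (ob G' Y))"]
      by (simp add: in_hom)
    finally show "(\<xi>' Z \<cdot>\<^bsub>C\<^esub> ar F' (\<xi> (ob G' Z))) \<cdot>\<^bsub>C\<^esub> ar ((F' \<circ>\<^sub>F F) \<circ>\<^sub>F G \<circ>\<^sub>F G') g =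
        ar id_functor g \<cdot>\<^bsub>C\<^esub> (\<xi>' Y \<cdot>\<^bsub>C\<^esub> ar F' (\<xi> (ob G' Y)))"
      by simp
  next
    fix X assume X: "X \<in> Obj A"
    have "\<xi> (ob G' (ob F' (ob F X))) \<cdot>\<^bsub>B\<^esub> ar F (ar G (\<eta>' (ob F X))) = \<eta>' (ob F X) \<cdot>\<^bsub>B\<^esub> \<xi> (ob F X)"
      using X L.counit_natural[of "\<eta>' (ob F X)" "ob F X"] by simp
    then have "ar F' (\<xi> (ob G' (ob F' (ob F X)))) \<cdot>\<^bsub>C\<^esub> ar F' (ar F (ar G (\<eta>' (ob F X)))) =
        ar F' (\<eta>' (ob F X)) \<cdot>\<^bsub>C\<^esub> ar F' (\<xi> (ob F X))"
      using X R.H.ar_eq_Comp by fastforce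
    note * = R.H.B.extend[OF this, of "ar F' (ar F (\<eta> X))"]
    have "ar F' (\<xi> (ob F X)) \<cdot>\<^bsub>C\<^esub> ar F' (ar F (\<eta> X)) = Id C (ob F' (ob F X))"
      using X R.H.ar_eq_Comp[OF L.triangle_H[OF X]] by simp
    then show "(\<xi>' (ob (F' \<circ>\<^sub>F F) X) \<cdot>\<^bsub>C\<^esub> ar F' (\<xi> (ob G' (ob (F' \<circ>\<^sub>F F) X)))) \<cdot>\<^bsub>C\<^esub>
        ar (F' \<circ>\<^sub>F F) (ar G (\<eta>' (ob F X)) \<cdot>\<^bsub>A\<^esub> \<eta> X) = Id C (ob (F' \<circ>\<^sub>F F) X)"
      using X * R.triangle_H[of "ob F X"] by simp
  next
    fix Z assume Z: "Z \<in> Obj C"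
    have "\<eta>' (ob G' Z) \<cdot>\<^bsub>B\<^esub> \<xi> (ob G' Z) =
        ar G' (ar F' (\<xi> (ob G' Z))) \<cdot>\<^bsub>B\<^esub> \<eta>' (ob F (ob G (ob G' Z)))"
      using Z R.unit_natural[of "\<xi> (ob G' Z)" "ob F (ob G (ob G' Z))" "ob G' Z"] by simp
    then have "ar G (ar G' (ar F' (\<xi> (ob G' Z)))) \<cdot>\<^bsub>A\<^esub> ar G (\<eta>' (ob F (ob G (ob G' Z)))) =
        ar G (\<eta>' (ob G' Z)) \<cdot>\<^bsub>A\<^esub> ar G (\<xi> (ob G' Z))"
      using Z L.K.ar_eq_Comp by fastforce
    note * = L.H.A.extend[OF this, of "\<eta> (ob G (ob G' Z))"]
    have "ar G (ar G' (\<xi>' Z)) \<cdot>\<^bsub>A\<^esub> ar G (\<eta>' (ob G' Z)) = Id A (ob G (ob G' Z))"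
      using Z L.K.ar_eq_Comp[OF R.triangle_K[OF Z]] by simp
    then show "ar (G \<circ>\<^sub>F G') (\<xi>' Z \<cdot>\<^bsub>C\<^esub> ar F' (\<xi> (ob G' Z))) \<cdot>\<^bsub>A\<^esub>
        (ar G (\<eta>' (ob F (ob (G \<circ>\<^sub>F G') Z))) \<cdot>\<^bsub>A\<^esub> \<eta> (ob (G \<circ>\<^sub>F G') Z)) = Id A (ob (G \<circ>\<^sub>F G') Z)"
      using Z * L.triangle_K[of "ob G' Z"] by simp
  qed (auto simp: in_hom)
qed

section \<open>The category of coalgebras over its base\<close>

definition forgetful :: "('o \<times> 'm, ('o \<times> 'm) \<times> 'm \<times> ('o \<times> 'm), 'o, 'm) functor_data" where
  "forgetful = \<lparr>ob = fst, ar = \<lambda>u. fst (snd u)\<rparr>"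

text \<open>A coalgebra morphism carries its domain and codomain, so the action of the cofree functor
  on an arrow has to supply both cofree coalgebras.\<close>

definition cofree where
  "cofree M C \<delta> =
     \<lparr>ob = \<lambda>X. (ob C X, \<delta> X),
      ar = \<lambda>f. ((ob C (Dom M f), \<delta> (Dom M f)), ar C f, (ob C (Cod M f), \<delta> (Cod M f)))\<rparr>"

text \<open>The structure map of a coalgebra, seen as a morphism to a cofree coalgebra.\<close>

definition cofree_unit ::
  "('o, 'm, 'o, 'm) functor_data \<Rightarrow> ('o \<Rightarrow> 'm) \<Rightarrow> 'o \<times> 'm \<Rightarrow> ('o \<times> 'm) \<times> 'm \<times> ('o \<times> 'm)"
  where
  "cofree_unit C \<delta> P = (P, snd P, (ob C (fst P), \<delta> (fst P)))"

lemma forgetful_cofree_simps [simp]: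
  "ob forgetful P = fst P" "ar forgetful u = fst (snd u)"
  "ob (cofree M C \<delta>) X = (ob C X, \<delta> X)"
  "ar (cofree M C \<delta>) f =
     ((ob C (Dom M f), \<delta> (Dom M f)), ar C f, (ob C (Cod M f), \<delta> (Cod M f)))"
  by (simp_all add: forgetful_def cofree_def)

context comonad
begin

lemma comult_simps [simp]:
  assumes "X \<in> Obj M"
  shows "\<delta> X \<in> Arr M" "Dom M (\<delta> X) = ob C X" "Cod M (\<delta> X) = ob C (ob C X)"
  using \<delta>.component_simps[OF assms] by simp_all

lemma comonad_counit_simps [simp]:
  assumes "X \<in> Obj M"
  shows "\<epsilon> X \<in> Arr M" "Dom M (\<epsilon> X) = ob C X" "Cod M (\<epsilon> X) = X"
  using \<epsilon>.component_simps[OF assms] by simp_all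

lemma comult_natural:
  "f \<in> Arr M \<Longrightarrow> Dom M f = X \<Longrightarrow> Cod M f = X' \<Longrightarrow>
     \<delta> X' \<cdot>\<^bsub>M\<^esub> ar C f = ar C (ar C f) \<cdot>\<^bsub>M\<^esub> \<delta> X"
  using \<delta>.naturality_Arr[of f X X'] by simp

lemma comonad_counit_natural:
  "f \<in> Arr M \<Longrightarrow> Dom M f = X \<Longrightarrow> Cod M f = X' \<Longrightarrow> \<epsilon> X' \<cdot>\<^bsub>M\<^esub> ar C f = f \<cdot>\<^bsub>M\<^esub> \<epsilon> X"
  using \<epsilon>.naturality_Arr[of f X X'] by simp

lemma cofree_coalgebra: "X \<in> Obj M \<Longrightarrow> coalgebra M C \<delta> \<epsilon> (ob C X, \<delta> X)"
  by (rule coalgebraI) (simp_all add: in_hom coassoc counit_left)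

lemma cofree_adjunction:
  "adjunction (coalgebras M C \<delta> \<epsilon>) M forgetful (cofree M C \<delta>) (cofree_unit C \<delta>) \<epsilon>"
proof -
  interpret E: category "coalgebras M C \<delta> \<epsilon>"
    by (rule category_coalgebras[OF C.is_functor_axioms])
  interpret U: is_functor "coalgebras M C \<delta> \<epsilon>" M forgetful
    by unfold_locales (auto simp: in_hom_coalgebras dest: coalgebraD(1))
  interpret R: is_functor M "coalgebras M C \<delta> \<epsilon>" "cofree M C \<delta>"
    by unfold_locales (auto simp: in_hom cofree_coalgebra comult_natural)
  interpret UR: is_functor M M "forgetful \<circ>\<^sub>F cofree M C \<delta>"
    by (rule is_functor_comp[OF R.is_functor_axioms U.is_functor_axioms])
  interpret RU: is_functor "coalgebras M C \<delta> \<epsilon>" "coalgebras M C \<delta> \<epsilon>"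
    "cofree M C \<delta> \<circ>\<^sub>F forgetful"
    by (rule is_functor_comp[OF U.is_functor_axioms R.is_functor_axioms])
  show ?thesis
  proof unfold_locales
    fix P assume "P \<in> Obj (coalgebras M C \<delta> \<epsilon>)"
    then have P: "coalgebra M C \<delta> \<epsilon> P"
      by simp
    note d = coalgebraD[OF P]
    show "cofree_unit C \<delta> P \<in> hom (coalgebras M C \<delta> \<epsilon>) (ob id_functor P)
        (ob (cofree M C \<delta> \<circ>\<^sub>F forgetful) P)"
      using P d by (simp add: triple_in_hom_coalgebras cofree_unit_def cofree_coalgebra in_hom)
    show "\<epsilon> (ob forgetful P) \<cdot>\<^bsub>M\<^esub> ar forgetful (cofree_unit C \<delta> P) = Id M (ob forgetful P)"
      using d(6) by (simp add: cofree_unit_def)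
  next
    fix u P Q assume "u \<in> hom (coalgebras M C \<delta> \<epsilon>) P Q"
    then show "cofree_unit C \<delta> Q \<cdot>\<^bsub>coalgebras M C \<delta> \<epsilon>\<^esub> ar id_functor u =
        ar (cofree M C \<delta> \<circ>\<^sub>F forgetful) u \<cdot>\<^bsub>coalgebras M C \<delta> \<epsilon>\<^esub> cofree_unit C \<delta> P"
      by (auto simp: in_hom_coalgebras cofree_unit_def in_hom[of _ M])
  qed (auto simp: in_hom[of _ M] comonad_counit_natural cofree_unit_def counit_right)
qed

text \<open>The forgetful functor creates an equalizer that \<open>C\<close> and \<open>C\<^sup>2\<close> preserve.  The structure map
  \<open>k : E \<rightarrow> C E\<close> is the factorisation of \<open>c e\<close> through the equalizer \<open>C e\<close>.  The counit law holds
  because \<open>e\<close> is monic, coassociativity because \<open>C (C e)\<close> is, and a factorisation through \<open>e\<close> is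
  a coalgebra morphism because \<open>C e\<close> is.\<close>

lemma coalgebras_equalizer:
  assumes u: "(P, f, Q) \<in> hom (coalgebras M C \<delta> \<epsilon>) P Q"
    and v: "(P, g, Q) \<in> hom (coalgebras M C \<delta> \<epsilon>) P Q"
    and eq: "is_equalizer M e f g"
    and C_eq: "is_equalizer M (ar C e) (ar C f) (ar C g)"
    and CC_eq: "is_equalizer M (ar C (ar C e)) (ar C (ar C f)) (ar C (ar C g))"
  obtains D where "is_equalizer (coalgebras M C \<delta> \<epsilon>) (D, e, P) (P, f, Q) (P, g, Q)"
proof -
  interpret E: category "coalgebras M C \<delta> \<epsilon>"
    by (rule category_coalgebras[OF C.is_functor_axioms])
  obtain X c where P: "P = (X, c)"
    by (cases P)
  obtain Y d where Q: "Q = (Y, d)"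
    by (cases Q)
  have coalg_P: "coalgebra M C \<delta> \<epsilon> P" and coalg_Q: "coalgebra M C \<delta> \<epsilon> Q"
    and f_hom: "f \<in> hom M X Y" and g_hom: "g \<in> hom M X Y"
    and df: "d \<cdot>\<^bsub>M\<^esub> f = ar C f \<cdot>\<^bsub>M\<^esub> c" and dg: "d \<cdot>\<^bsub>M\<^esub> g = ar C g \<cdot>\<^bsub>M\<^esub> c"
    using u v P Q by (auto simp: triple_in_hom_coalgebras)
  note c = coalgebraD[OF coalg_P, unfolded P fst_conv snd_conv]
  note d = coalgebraD[OF coalg_Q, unfolded Q fst_conv snd_conv]
  define E where "E = Dom M e"
  have e_hom: "e \<in> hom M E X"
    using is_equalizerD(1,2)[OF eq] f_hom by (simp add: E_def in_hom)
  have E: "E \<in> Obj M"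
    using e_hom by (auto simp: in_hom)
  note Ce_hom = C.ar_hom[OF e_hom]
  note CCe_hom = C.ar_hom[OF Ce_hom]
  note typing = c(1-4) d(1-4) E e_hom[unfolded in_hom] f_hom[unfolded in_hom] g_hom[unfolded in_hom]
  have "ar C f \<cdot>\<^bsub>M\<^esub> (c \<cdot>\<^bsub>M\<^esub> e) = d \<cdot>\<^bsub>M\<^esub> (f \<cdot>\<^bsub>M\<^esub> e)"
    using typing C.A.extend[OF df, of e] by simp
  also have "\<dots> = d \<cdot>\<^bsub>M\<^esub> (g \<cdot>\<^bsub>M\<^esub> e)"
    using is_equalizerD(4)[OF eq] by simp
  also have "\<dots> = ar C g \<cdot>\<^bsub>M\<^esub> (c \<cdot>\<^bsub>M\<^esub> e)"
    using typing C.A.extend[OF dg, of e] by simp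
  finally obtain k where k: "k \<in> hom M E (ob C E)" and Ce_k: "ar C e \<cdot>\<^bsub>M\<^esub> k = c \<cdot>\<^bsub>M\<^esub> e"
    using is_equalizer_factor[OF C_eq Ce_hom, of "c \<cdot>\<^bsub>M\<^esub> e" E] typing by (auto simp: in_hom)
  note typing = typing k[unfolded in_hom]
  have coalg: "coalgebra M C \<delta> \<epsilon> (E, k)"
  proof (rule coalgebraI[OF E k])
    have "e \<cdot>\<^bsub>M\<^esub> (\<epsilon> E \<cdot>\<^bsub>M\<^esub> k) = \<epsilon> X \<cdot>\<^bsub>M\<^esub> (ar C e \<cdot>\<^bsub>M\<^esub> k)"
      using typing C.A.extend[OF comonad_counit_natural[of e E X], of k] by simp
    also have "\<dots> = e \<cdot>\<^bsub>M\<^esub> Id M E"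
      unfolding Ce_k using typing C.A.extend[OF c(6), of e] by simp
    finally show "\<epsilon> E \<cdot>\<^bsub>M\<^esub> k = Id M E"
      by (rule C.A.is_equalizer_mono[OF eq e_hom, rotated 2])
        (use typing in \<open>simp_all add: in_hom\<close>)
    have "ar C (ar C e) \<cdot>\<^bsub>M\<^esub> (\<delta> E \<cdot>\<^bsub>M\<^esub> k) = \<delta> X \<cdot>\<^bsub>M\<^esub> (ar C e \<cdot>\<^bsub>M\<^esub> k)"
      using typing C.A.extend[OF comult_natural[of e E X], of k] by simp
    also have "\<dots> = ar C c \<cdot>\<^bsub>M\<^esub> (c \<cdot>\<^bsub>M\<^esub> e)"
      unfolding Ce_k using typing C.A.extend[OF c(5), of e] by simp
    also have "\<dots> = ar C c \<cdot>\<^bsub>M\<^esub> (ar C e \<cdot>\<^bsub>M\<^esub> k)"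
      by (simp only: Ce_k)
    also have "\<dots> = ar C (c \<cdot>\<^bsub>M\<^esub> e) \<cdot>\<^bsub>M\<^esub> k"
      using typing by simp
    also have "\<dots> = ar C (ar C e \<cdot>\<^bsub>M\<^esub> k) \<cdot>\<^bsub>M\<^esub> k"
      by (simp only: Ce_k)
    also have "\<dots> = ar C (ar C e) \<cdot>\<^bsub>M\<^esub> (ar C k \<cdot>\<^bsub>M\<^esub> k)"
      using typing by simp
    finally show "\<delta> E \<cdot>\<^bsub>M\<^esub> k = ar C k \<cdot>\<^bsub>M\<^esub> k"
      by (rule C.A.is_equalizer_mono[OF CC_eq CCe_hom, rotated 2])
        (use typing in \<open>simp_all add: in_hom\<close>)
  qed
  have "is_equalizer (coalgebras M C \<delta> \<epsilon>) ((E, k), e, P) (P, f, Q) (P, g, Q)"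
  proof (rule is_equalizerI)
    show "((E, k), e, P) \<in> hom (coalgebras M C \<delta> \<epsilon>) (E, k) P"
      using coalg coalg_P e_hom Ce_k P by (simp add: triple_in_hom_coalgebras)
    show "(P, f, Q) \<in> hom (coalgebras M C \<delta> \<epsilon>) P Q" "(P, g, Q) \<in> hom (coalgebras M C \<delta> \<epsilon>) P Q"
      by (fact u v)+
    show "(P, f, Q) \<cdot>\<^bsub>coalgebras M C \<delta> \<epsilon>\<^esub> ((E, k), e, P) =
        (P, g, Q) \<cdot>\<^bsub>coalgebras M C \<delta> \<epsilon>\<^esub> ((E, k), e, P)"
      using is_equalizerD(4)[OF eq] by simp
  next
    fix R w
    assume w_hom: "w \<in> hom (coalgebras M C \<delta> \<epsilon>) R P"
      and w_eq: "(P, f, Q) \<cdot>\<^bsub>coalgebras M C \<delta> \<epsilon>\<^esub> w = (P, g, Q) \<cdot>\<^bsub>coalgebras M C \<delta> \<epsilon>\<^esub> w"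
    obtain Z z where R: "R = (Z, z)"
      by (cases R)
    obtain h where w: "w = (R, h, P)" and coalg_R: "coalgebra M C \<delta> \<epsilon> R"
      and h: "h \<in> hom M Z X" and ch: "c \<cdot>\<^bsub>M\<^esub> h = ar C h \<cdot>\<^bsub>M\<^esub> z"
      using w_hom P R by (auto simp: in_hom_coalgebras)
    have "f \<cdot>\<^bsub>M\<^esub> h = g \<cdot>\<^bsub>M\<^esub> h"
      using w_eq w by simp
    then obtain l where l: "l \<in> hom M Z E" "e \<cdot>\<^bsub>M\<^esub> l = h"
      using is_equalizer_factor[OF eq e_hom h] by blast
    note z = coalgebraD(1-4)[OF coalg_R, unfolded R fst_conv snd_conv]
    note typing = typing z h[unfolded in_hom] l(1)[unfolded in_hom]
    have "ar C e \<cdot>\<^bsub>M\<^esub> (k \<cdot>\<^bsub>M\<^esub> l) = c \<cdot>\<^bsub>M\<^esub> (e \<cdot>\<^bsub>M\<^esub> l)"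
      using typing C.A.extend[OF Ce_k, of l] by simp
    also have "\<dots> = ar C (e \<cdot>\<^bsub>M\<^esub> l) \<cdot>\<^bsub>M\<^esub> z"
      unfolding l(2) by (rule ch)
    also have "\<dots> = ar C e \<cdot>\<^bsub>M\<^esub> (ar C l \<cdot>\<^bsub>M\<^esub> z)"
      using typing by simp
    finally have "k \<cdot>\<^bsub>M\<^esub> l = ar C l \<cdot>\<^bsub>M\<^esub> z"
      by (rule C.A.is_equalizer_mono[OF C_eq Ce_hom, rotated 2])
        (use typing in \<open>simp_all add: in_hom\<close>)
    then have "(R, l, (E, k)) \<in> hom (coalgebras M C \<delta> \<epsilon>) R (E, k)"
      using coalg_R coalg l(1) R by (simp add: triple_in_hom_coalgebras)
    moreover have "((E, k), e, P) \<cdot>\<^bsub>coalgebras M C \<delta> \<epsilon>\<^esub> (R, l, (E, k)) = w"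
      using l(2) w by simp
    ultimately show "\<exists>a \<in> hom (coalgebras M C \<delta> \<epsilon>) R (E, k).
        ((E, k), e, P) \<cdot>\<^bsub>coalgebras M C \<delta> \<epsilon>\<^esub> a = w"
      by blast
  next
    fix R a b
    assume "a \<in> hom (coalgebras M C \<delta> \<epsilon>) R (E, k)" "b \<in> hom (coalgebras M C \<delta> \<epsilon>) R (E, k)"
      and eq': "((E, k), e, P) \<cdot>\<^bsub>coalgebras M C \<delta> \<epsilon>\<^esub> a = ((E, k), e, P) \<cdot>\<^bsub>coalgebras M C \<delta> \<epsilon>\<^esub> b"
    then obtain l l' where "a = (R, l, (E, k))" "b = (R, l', (E, k))"
      and "l \<in> hom M (fst R) E" "l' \<in> hom M (fst R) E"
      by (auto simp: in_hom_coalgebras)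
    then show "a = b"
      using C.A.is_equalizer_mono[OF eq e_hom, of l "fst R" l'] eq' by simp
  qed
  then show thesis
    by (rule that)
qed

end

section \<open>Comparison functors of comonads\<close>

text \<open>The data of the composite adjunction agree with the conjugate comonad and with the comparison
  functor on objects and arrows of the categories, but not at arguments outside of them;
  hence the two congruence lemmas.\<close>

lemma comparison_equivalence:
  assumes adj: "adjunction M N H K \<eta> \<xi>" and com: "comonad M C \<delta> \<epsilon>"
    and beck: "beck_conditions (coalgebras M C \<delta> \<epsilon>) N (H \<circ>\<^sub>F forgetful)"
  shows "is_equivalence (coalgebras M C \<delta> \<epsilon>)
    (coalgebras N (conj_functor H K C) (conj_comult N H K \<eta> C \<delta>) (conj_counit N H K \<xi> \<epsilon>))
    (comparison N H \<eta> C)"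
proof -
  interpret HK: adjunction M N H K \<eta> \<xi> by fact
  interpret C: comonad M C \<delta> \<epsilon> by fact
  let ?A = "coalgebras M C \<delta> \<epsilon>" and ?L = "H \<circ>\<^sub>F forgetful" and ?R = "cofree M C \<delta> \<circ>\<^sub>F K"
  let ?unit = "\<lambda>P. ar (cofree M C \<delta>) (\<eta> (ob forgetful P)) \<cdot>\<^bsub>?A\<^esub> cofree_unit C \<delta> P"
  let ?counit = "\<lambda>Y. \<xi> Y \<cdot>\<^bsub>N\<^esub> ar H (\<epsilon> (ob K Y))"
  interpret LR: adjunction ?A N ?L ?R ?unit ?counit
    by (rule adjunction_comp[OF C.cofree_adjunction adj])
  have "?L \<circ>\<^sub>F ?R = conj_functor H K C"
    by (simp add: conj_functor_def comp_functor_def)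
  moreover have "coalgebras N T (\<lambda>Y. ar ?L (?unit (ob ?R Y))) ?counit =
      coalgebras N T (conj_comult N H K \<eta> C \<delta>) (conj_counit N H K \<xi> \<epsilon>)" for T
    by (rule coalgebras_cong) (simp_all add: conj_comult_def conj_counit_def cofree_unit_def)
  ultimately have "is_equivalence ?A
      (coalgebras N (conj_functor H K C) (conj_comult N H K \<eta> C \<delta>) (conj_counit N H K \<xi> \<epsilon>))
      (canonical_comparison ?A ?L ?unit)"
    using LR.beck_sufficient[OF beck] by simp
  then show ?thesis
  proof (rule is_equivalence_cong)
    show ob_eq: "ob (canonical_comparison ?A ?L ?unit) P = ob (comparison N H \<eta> C) P"
      if "P \<in> Obj ?A" for P
      using that coalgebraD[of M C \<delta> \<epsilon> P]
      by (cases P) (simp add: comparison_def comparison_ob_def cofree_unit_def)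
    show "ar (canonical_comparison ?A ?L ?unit) u = ar (comparison N H \<eta> C) u" if "u \<in> Arr ?A" for u
    proof -
      obtain P f Q where u: "u = (P, f, Q)"
        by (cases u) auto
      with that have "P \<in> Obj ?A" "Q \<in> Obj ?A"
        by simp_all
      from this[THEN ob_eq] show ?thesis
        by (simp add: u comparison_def)
    qed
  qed
qed

text \<open>A coreflexive pair of coalgebra morphisms that is split by \<open>H U\<close> has an underlying pair in
  \<open>M\<close> that is coreflexive and \<open>H\<close>-split.  Its equalizer in \<open>M\<close> lifts along \<open>U\<close>, and an arbitrary
  equalizer of the given pair differs from the lifted one by an isomorphism, which \<open>H U\<close>
  preserves.\<close>

lemma beck_conditions_coalgebras:
  assumes adj: "adjunction M N H K \<eta> \<xi>" and com: "comonad M C \<delta> \<epsilon>"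
    and preserve: "\<And>f g. coreflexive_pair M f g \<Longrightarrow> functor_split N H f g \<Longrightarrow>
       preserves_equalizer M M C f g \<and> preserves_equalizer M M (C \<circ>\<^sub>F C) f g"
    and beck: "beck_conditions M N H"
  shows "beck_conditions (coalgebras M C \<delta> \<epsilon>) N (H \<circ>\<^sub>F forgetful)"
proof -
  interpret HK: adjunction M N H K \<eta> \<xi> by fact
  interpret C: comonad M C \<delta> \<epsilon> by fact
  let ?A = "coalgebras M C \<delta> \<epsilon>"
  interpret A: category ?A
    by (rule category_coalgebras[OF C.C.is_functor_axioms])
  have lift: "\<exists>e. is_equalizer ?A e u v \<and> is_equalizer N (ar H (fst (snd e)))
      (ar H (fst (snd u))) (ar H (fst (snd v))) \<and> u \<in> hom ?A (Cod ?A e) (Cod ?A u)"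
    if pair: "coreflexive_pair ?A u v" and split: "functor_split N (H \<circ>\<^sub>F forgetful) u v" for u v
  proof -
    obtain P Q r where uv: "u \<in> hom ?A P Q" "v \<in> hom ?A P Q" and r: "r \<in> hom ?A Q P"
      "r \<cdot>\<^bsub>?A\<^esub> u = Id ?A P" "r \<cdot>\<^bsub>?A\<^esub> v = Id ?A P"
      using pair unfolding coreflexive_pair_def by blast
    obtain f where u: "u = (P, f, Q)" "f \<in> hom M (fst P) (fst Q)"
      using uv(1) by (auto simp: in_hom_coalgebras)
    obtain g where v: "v = (P, g, Q)" "g \<in> hom M (fst P) (fst Q)"
      using uv(2) by (auto simp: in_hom_coalgebras)
    obtain s where s: "r = (Q, s, P)" "s \<in> hom M (fst Q) (fst P)"
      using r(1) by (auto simp: in_hom_coalgebras)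
    have corefl: "coreflexive_pair M f g"
      unfolding coreflexive_pair_def using u v s r(2,3) by auto
    have split': "functor_split N H f g"
      using split u v by (simp add: functor_split_def)
    obtain e where e: "is_equalizer M e f g"
      using beck corefl split' unfolding beck_conditions_def by blast
    have "is_equalizer M (ar C e) (ar C f) (ar C g)"
      "is_equalizer M (ar C (ar C e)) (ar C (ar C f)) (ar C (ar C g))"
      using preserve[OF corefl split'] e by (auto simp: preserves_equalizer_def)
    then obtain D where D: "is_equalizer ?A (D, e, P) u v"
      using C.coalgebras_equalizer[of P f Q g e] uv e u(1) v(1) by blast
    moreover have "is_equalizer N (ar H e) (ar H f) (ar H g)"
      using beck corefl split' e unfolding beck_conditions_def preserves_equalizer_def by blast
    ultimately show ?thesis
      using uv u(1) v(1) by (intro exI[of _ "(D, e, P)"]) simp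
  qed
  have "preserves_equalizer ?A N (H \<circ>\<^sub>F forgetful) u v"
    if uv: "coreflexive_pair ?A u v" "functor_split N (H \<circ>\<^sub>F forgetful) u v" for u v
    unfolding preserves_equalizer_def
  proof (intro allI impI)
    fix d assume d: "is_equalizer ?A d u v"
    obtain e where e: "is_equalizer ?A e u v"
      and He: "is_equalizer N (ar H (fst (snd e))) (ar H (fst (snd u))) (ar H (fst (snd v)))"
      and u: "u \<in> hom ?A (Cod ?A e) (Cod ?A u)"
      using lift[OF uv] by blast
    have e_hom: "e \<in> hom ?A (Dom ?A e) (Dom ?A u)"
      using is_equalizerD(1,2)[OF e] by (metis in_hom)
    have d_hom: "d \<in> hom ?A (Dom ?A d) (Dom ?A u)"
      using is_equalizerD(1,2)[OF d] by (metis in_hom)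
    obtain k where k: "k \<in> hom ?A (Dom ?A d) (Dom ?A e)" "e \<cdot>\<^bsub>?A\<^esub> k = d" "is_iso ?A k"
      using A.equalizers_iso[OF e d e_hom d_hom] .
    obtain P e' R Q d' R' where ed: "e = (P, e', R)" "d = (Q, d', R')"
      by (cases e, cases d) auto
    obtain k' where k': "k = (Q, k', P)"
      using k(1) ed by (auto simp: in_hom_coalgebras)
    note eq = ed k'
    have hom: "e' \<in> hom M (fst P) (fst R)" "k' \<in> hom M (fst Q) (fst P)"
      using e_hom k(1) eq by (simp_all add: triple_in_hom_coalgebras)
    have "is_iso M k'"
      using is_iso_coalgebras_iff[OF C.C.is_functor_axioms, of Q k' P] k(1,3) eq by simp
    then have iso: "is_iso N (ar H k')"
      by (rule HK.H.preserves_iso)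
    have comp: "e' \<cdot>\<^bsub>M\<^esub> k' = d'"
      using k(2) eq by simp
    have "ar H e' \<cdot>\<^bsub>N\<^esub> ar H k' = ar H d'"
      using HK.H.ar_eq_Comp[OF comp] hom by (simp add: in_hom)
    then show "is_equalizer N (ar (H \<circ>\<^sub>F forgetful) d) (ar (H \<circ>\<^sub>F forgetful) u)
        (ar (H \<circ>\<^sub>F forgetful) v)"
      using HK.H.B.is_equalizer_Comp_iso[OF _ iso HK.H.ar_hom[OF hom(1)] HK.H.ar_hom[OF hom(2)]]
        He eq by simp
  qed
  moreover have "conservative ?A N (H \<circ>\<^sub>F forgetful)"
    unfolding conservative_def
  proof (intro ballI impI)
    fix u assume u: "u \<in> Arr ?A" "is_iso N (ar (H \<circ>\<^sub>F forgetful) u)"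
    obtain P f Q where "u = (P, f, Q)"
      by (cases u) auto
    with u show "is_iso ?A u"
      using is_iso_coalgebras_iff[OF C.C.is_functor_axioms, of P f Q \<delta> \<epsilon>] beck
      by (simp add: beck_conditions_def conservative_def in_hom)
  qed
  ultimately show ?thesis
    unfolding beck_conditions_def using lift by blast
qed

lemma identity_comonad:
  assumes "category M"
  shows "comonad M id_functor (Id M) (Id M)"
proof -
  interpret category M by fact
  show ?thesis
    by unfold_locales (auto simp: in_hom)
qed

text \<open>The counit law forces the structure map of a coalgebra of the identity comonad to be an
  identity.\<close>

lemma identity_cofree_equivalence:
  assumes "category M"
  shows "is_equivalence M (coalgebras M id_functor (Id M) (Id M)) (cofree M id_functor (Id M))"
proof -
  interpret M: category M by fact
  interpret I: comonad M id_functor "Id M" "Id M"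
    by (rule identity_comonad[OF assms])
  interpret J: adjunction "coalgebras M id_functor (Id M) (Id M)" M forgetful
    "cofree M id_functor (Id M)" "cofree_unit id_functor (Id M)" "Id M"
    by (rule I.cofree_adjunction)
  show ?thesis
  proof (rule J.K.is_equivalenceI)
    show "fully_faithful M (coalgebras M id_functor (Id M) (Id M)) (cofree M id_functor (Id M))"
      by (rule J.K.fully_faithfulI) (auto simp: in_hom_coalgebras in_hom[of _ M])
    show "essentially_surjective M (coalgebras M id_functor (Id M) (Id M))
        (cofree M id_functor (Id M))"
      unfolding essentially_surjective_def
    proof
      let ?A = "coalgebras M id_functor (Id M) (Id M)"
      fix P assume P: "P \<in> Obj ?A"
      then have "snd P = Id M (fst P)"
        using coalgebraD[of M id_functor "Id M" "Id M" P] by simp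
      then have "ob (cofree M id_functor (Id M)) (fst P) = P"
        by (cases P) simp
      moreover have "is_iso ?A (Id ?A P)"
        by (rule is_isoI[of _ _ P P "Id ?A P"])
          (use P J.H.A.Id_hom in \<open>simp_all add: J.H.A.Comp_Id del: coalgebras_simps\<close>)
      ultimately show "\<exists>X \<in> Obj M. \<exists>i \<in> hom ?A (ob (cofree M id_functor (Id M)) X) P. is_iso ?A i"
        using P J.H.A.Id_hom[OF P] coalgebraD(1)[of M id_functor "Id M" "Id M" P]
        by (intro bexI[of _ "fst P"] bexI[of _ "Id ?A P"]) simp_all
    qed
  qed
qed

lemma comonadic_if_identity_comparison_equivalence:
  assumes adj: "adjunction M N H K \<eta> \<xi>"
    and equiv: "is_equivalence (coalgebras M id_functor (Id M) (Id M))
      (coalgebras N (conj_functor H K id_functor) (conj_comult N H K \<eta> id_functor (Id M))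
        (conj_counit N H K \<xi> (Id M)))
      (comparison N H \<eta> id_functor)"
  shows "is_equivalence M (coalgebras N (H \<circ>\<^sub>F K) (\<lambda>Y. ar H (\<eta> (ob K Y))) \<xi>)
    (canonical_comparison M H \<eta>)"
proof -
  interpret adjunction M N H K \<eta> \<xi> by fact
  have "conj_functor H K id_functor = H \<circ>\<^sub>F K"
    by (simp add: conj_functor_def comp_functor_def id_functor_def)
  moreover have "coalgebras N T (conj_comult N H K \<eta> id_functor (Id M)) (conj_counit N H K \<xi> (Id M))
      = coalgebras N T (\<lambda>Y. ar H (\<eta> (ob K Y))) \<xi>" for T
    by (rule coalgebras_cong) (simp_all add: conj_comult_def conj_counit_def)
  ultimately have "is_equivalence M (coalgebras N (H \<circ>\<^sub>F K) (\<lambda>Y. ar H (\<eta> (ob K Y))) \<xi>)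
      (comparison N H \<eta> id_functor \<circ>\<^sub>F cofree M id_functor (Id M))"
    using is_equivalence_comp[OF identity_cofree_equivalence[OF H.A.category_axioms] equiv] by simp
  then show ?thesis
    by (rule is_equivalence_cong) (simp_all add: comparison_def comparison_ob_def)
qed

theorem theorem2p8:
  fixes M :: "('o, 'm) cat" and N :: "('p, 'n) cat"
    and H :: "('o, 'm, 'p, 'n) functor_data" and K :: "('p, 'n, 'o, 'm) functor_data"
    and \<eta> :: "'o \<Rightarrow> 'm" and \<xi> :: "'p \<Rightarrow> 'n"
  assumes "adjunction M N H K \<eta> \<xi>"
  shows "(\<forall>C \<delta> \<epsilon>. comonad M C \<delta> \<epsilon> \<longrightarrow>
            (\<forall>f g. coreflexive_pair M f g \<longrightarrow> functor_split N H f g \<longrightarrow>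
               preserves_equalizer M M C f g \<and> preserves_equalizer M M (C \<circ>\<^sub>F C) f g) \<longrightarrow>
            is_equivalence (coalgebras M C \<delta> \<epsilon>)
              (coalgebras N (conj_functor H K C) (conj_comult N H K \<eta> C \<delta>)
                 (conj_counit N H K \<xi> \<epsilon>))
              (comparison N H \<eta> C))
    \<longleftrightarrow> ((\<forall>f g. coreflexive_pair M f g \<longrightarrow> functor_split N H f g \<longrightarrow> (\<exists>e. is_equalizer M e f g)) \<and>
         (\<forall>f g. coreflexive_pair M f g \<longrightarrow> functor_split N H f g \<longrightarrow> preserves_equalizer M N H f g) \<and>
         conservative M N H)"
    (is "?equivalences \<longleftrightarrow> ?beck")
proof
  interpret adjunction M N H K \<eta> \<xi> by fact
  assume ?equivalences
  then have "is_equivalence (coalgebras M id_functor (Id M) (Id M))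
      (coalgebras N (conj_functor H K id_functor) (conj_comult N H K \<eta> id_functor (Id M))
        (conj_counit N H K \<xi> (Id M)))
      (comparison N H \<eta> id_functor)"
    using identity_comonad[OF H.A.category_axioms] by (simp add: preserves_equalizer_def)
  then show ?beck
    using beck_necessary comonadic_if_identity_comparison_equivalence[OF assms]
    unfolding beck_conditions_def by blast
next
  assume ?beck
  then have "beck_conditions M N H"
    by (simp add: beck_conditions_def)
  then show ?equivalences
    using comparison_equivalence[OF assms] beck_conditions_coalgebras[OF assms] by blast
qed

end
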